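(* Let $\mathcal A\subseteq\mathbb N$, $L$ an environment and $T$ a term with $L\vdash_{\mathcal A}T$. Then: (C) for all environments $L_1,L_2$, all terms $T_1,T_2$ and all $n_1,n_2\in\mathbb N$, if $L\Rightarrow L_1$, $L\Rightarrow L_2$, $L\vdash T\to^{*n_1}T_1$ and $L\vdash T\to^{*n_2}T_2$, then there exists a term $T'$ with $L_1\vdash T_1\to^{*(n_2\dot- n_1)}T'$ and $L_2\vdash T_2\to^{*(n_1\dot- n_2)}T'$; and (P) for every environment $L_2$, term $T_2$ and $n\in\mathbb N$, if $L\Rightarrow L_2$ and $L\vdash T\to^{n}T_2$, then $L_2\vdash_{\mathcal A}T_2$.
   Context: $a\dot- b$ denotes truncated subtraction ($\max(a-b,0)$). Fix a nonempty set $\Sigma$ of sorts with decidable equality, an arbitrary function $\mathrm{next}:\Sigma\to\Sigma$, and a countably infinite set of variables. Terms and environments: $T,U,V,W ::= \star s \mid x \mid \mathrm{app}(V,T) \mid \lambda x{:}W.\,T \mid \mathrm{def}(x{=}V).\,T \mid \mathrm{cast}(U,T)$ ($s\in\Sigma$) and $L,K ::= \emptyset \mid K,x{:}W \mid K,x{=}V$. $\mathrm{app}(V,T)$ applies $T$ to $V$; $\lambda x{:}W.\,T$ (de Bruijn's abstraction) and $\mathrm{def}(x{=}V).\,T$ (local definition) bind $x$ in $T$; $\mathrm{cast}(U,T)$ annotates $T$ with expected type $U$; entries $x{:}W$ (declaration) and $x{=}V$ (definition) bind $x$. Terms are modulo renaming of bound variables, with bound variables distinct from each other and from free ones. Write $\mathsf{B}x[V]$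 for either $\lambda x{:}V$ or $\mathrm{def}(x{=}V)$ and correspondingly $L,x[V]$ for $L,x{:}V$ resp. $L,x{=}V$ (same kind within a rule). One step of bound rt-reduction $L\vdash T_1\to^nT_2$ is the smallest relation closed under: $L\vdash\mathrm{app}(V,\lambda x{:}W.\,T)\to^0\mathrm{def}(x{=}\mathrm{cast}(W,V)).\,T$; $K,x{=}V\vdash x\to^0V$; $L\vdash\mathrm{def}(x{=}V).\,T\to^0T$ if $x$ not free in $T$; $L\vdash\mathrm{app}(V,\mathrm{def}(x{=}W).\,T)\to^0\mathrm{def}(x{=}W).\,\mathrm{app}(V,T)$; $L\vdash\mathrm{cast}(U,T)\to^0T$; $L\vdash\star s\to^1\star\,\mathrm{next}(s)$; $K,x{:}W\vdash x\to^1W$; $L\vdash\mathrm{cast}(U,T)\to^1U$; if $K\vdash x\to^nT$, $y\neq x$, $y$ not free in $T$ then $K,y[V]\vdash x\to^nT$; if $L\vdash V_1\to^0V_2$ then $L\vdash\mathrm{app}(V_1,T)\to^0\mathrm{app}(V_2,T)$; if $L\vdash T_1\to^nT_2$ then $L\vdash\mathrm{app}(V,T_1)\to^n\mathrm{app}(V,T_2)$; if $L\vdash V_1\to^0V_2$ then $L\vdash\mathsf Bx[V_1].\,T\to^0\mathsf Bx[V_2].\,T$; if $L,x[V]\vdash T_1\to^nT_2$ then $L\vdash\mathsf Bx[V].\,T_1\to^n\mathsf Bx[V].\,T_2$; if $L\vdash U_1\to^0U_2$ then $L\vdash\mathrm{cast}(U_1,T)\to^0\mathrm{cast}(U_2,T)$;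 if $L\vdash T_1\to^0T_2$ then $L\vdash\mathrm{cast}(U,T_1)\to^0\mathrm{cast}(U,T_2)$; if $L\vdash U_1\to^1U_2$ and $L\vdash T_1\to^1T_2$ then $L\vdash\mathrm{cast}(U_1,T_1)\to^1\mathrm{cast}(U_2,T_2)$. $L\vdash T_1\to^{*n}T_2$ is the smallest relation with $L\vdash T\to^{*0}T$, containing single steps, and with $L\vdash T_1\to^{*n_1}T$, $L\vdash T\to^{*n_2}T_2$ implying $L\vdash T_1\to^{*n_1+n_2}T_2$. One step of r-reduction for environments $L_1\Rightarrow L_2$ is the smallest relation such that $K_1\Rightarrow K_2$ implies $K_1,y[V]\Rightarrow K_2,y[V]$, and $K\vdash V_1\to^0V_2$ implies $K,y[V_1]\Rightarrow K,y[V_2]$. Validity $L\vdash_{\mathcal A}T$ is the smallest predicate closed under: $L\vdash_{\mathcal A}\star s$; if $K\vdash_{\mathcal A}V$ then $K,x[V]\vdash_{\mathcal A}x$; if $K\vdash_{\mathcal A}x$ and $y\neq x$ then $K,y[V]\vdash_{\mathcal A}x$; if $L\vdash_{\mathcal A}V$ and $L,x[V]\vdash_{\mathcal A}T$ then $L\vdash_{\mathcal A}\mathsf Bx[V].\,T$; if $L\vdash_{\mathcal A}U$, $L\vdash_{\mathcal A}T$ and some $U_0$ satisfies $L\vdash T\to^{*1}U_0$, $L\vdash U\to^{*0}U_0$, then $L\vdash_{\mathcal A}\mathrm{cast}(U,T)$; if $L\vdash_{\mathcal A}V$, $L\vdash_{\mathcal A}T$ and there are $n\in\mathcal A$, $x,W_0,U_0$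 with $L\vdash T\to^{*n}\lambda x{:}W_0.\,U_0$ and $L\vdash V\to^{*1}W_0$, then $L\vdash_{\mathcal A}\mathrm{app}(V,T)$. *)

theory Defs
  imports Main
begin

(* Terms modulo renaming of bound variables are represented with de Bruijn
   indices; sorts are the elements of the type 's.
   Bind b V T is the binder written Bx[V].T: index 0 of T is the variable x.
   App V T applies T to V: the argument comes first. *)

datatype binder_kind = Declaration | Definition

datatype 's tm =
    Sort 's
  | Var nat
  | App "'s tm" "'s tm"
  | Bind binder_kind "'s tm" "'s tm"
  | Cast "'s tm" "'s tm"

abbreviation Lambda :: "'s tm \<Rightarrow> 's tm \<Rightarrow> 's tm" where
  "Lambda W T \<equiv> Bind Declaration W T"

abbreviation Def :: "'s tm \<Rightarrow> 's tm \<Rightarrow> 's tm" where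
  "Def V T \<equiv> Bind Definition V T"

(* The environment K,x[V] is (b, V) # K, so the most recent entry is at the head
   and is denoted by index 0.  V lives in K.  Indices beyond the length of the
   environment stand for variables that it does not bind. *)

type_synonym 's env = "(binder_kind \<times> 's tm) list"

(* lift 0 T is the same named term T, regarded in an environment with one more
   entry y not free in T.  Conversely, a term under a binder does not contain
   the bound variable free iff it has the form lift 0 T. *)

primrec lift :: "nat \<Rightarrow> 's tm \<Rightarrow> 's tm" where
  "lift k (Sort s) = Sort s"
| "lift k (Var i) = Var (if i < k then i else Suc i)"
| "lift k (App V T) = App (lift k V) (lift k T)"
| "lift k (Bind b V T) = Bind b (lift k V) (lift (Suc k) T)"
| "lift k (Cast U T) = Cast (lift k U) (lift k T)"

inductive step :: "('s \<Rightarrow> 's) \<Rightarrow> 's env \<Rightarrow> nat \<Rightarrow> 's tm \<Rightarrow> 's tm \<Rightarrow> bool"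
  for nxt :: "'s \<Rightarrow> 's"
where
  beta: "step nxt L 0 (App V (Lambda W T)) (Def (Cast W V) T)"
| delta: "step nxt ((Definition, V) # K) 0 (Var 0) (lift 0 V)"
| zeta: "step nxt L 0 (Def V (lift 0 T)) T"
| theta: "step nxt L 0 (App V (Def W T)) (Def W (App (lift 0 V) T))"
| eps: "step nxt L 0 (Cast U T) T"
| sort: "step nxt L 1 (Sort s) (Sort (nxt s))"
| decl: "step nxt ((Declaration, W) # K) 1 (Var 0) (lift 0 W)"
| cast_type: "step nxt L 1 (Cast U T) U"
| var_Suc: "step nxt K n (Var i) T \<Longrightarrow> step nxt ((b, V) # K) n (Var (Suc i)) (lift 0 T)"
| app_left: "step nxt L 0 V1 V2 \<Longrightarrow> step nxt L 0 (App V1 T) (App V2 T)"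
| app_right: "step nxt L n T1 T2 \<Longrightarrow> step nxt L n (App V T1) (App V T2)"
| bind_left: "step nxt L 0 V1 V2 \<Longrightarrow> step nxt L 0 (Bind b V1 T) (Bind b V2 T)"
| bind_right: "step nxt ((b, V) # L) n T1 T2 \<Longrightarrow> step nxt L n (Bind b V T1) (Bind b V T2)"
| cast_left: "step nxt L 0 U1 U2 \<Longrightarrow> step nxt L 0 (Cast U1 T) (Cast U2 T)"
| cast_right: "step nxt L 0 T1 T2 \<Longrightarrow> step nxt L 0 (Cast U T1) (Cast U T2)"
| cast_both: "step nxt L 1 U1 U2 \<Longrightarrow> step nxt L 1 T1 T2 \<Longrightarrow> step nxt L 1 (Cast U1 T1) (Cast U2 T2)"

inductive steps :: "('s \<Rightarrow> 's) \<Rightarrow> 's env \<Rightarrow> nat \<Rightarrow> 's tm \<Rightarrow> 's tm \<Rightarrow> bool"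
  for nxt :: "'s \<Rightarrow> 's"
where
  refl: "steps nxt L 0 T T"
| single: "step nxt L n T1 T2 \<Longrightarrow> steps nxt L n T1 T2"
| trans: "steps nxt L n1 T1 T \<Longrightarrow> steps nxt L n2 T T2 \<Longrightarrow> steps nxt L (n1 + n2) T1 T2"

(* Exactly one entry is reduced, by exactly one step: the relation is not reflexive. *)

inductive env_step :: "('s \<Rightarrow> 's) \<Rightarrow> 's env \<Rightarrow> 's env \<Rightarrow> bool"
  for nxt :: "'s \<Rightarrow> 's"
where
  tail: "env_step nxt K1 K2 \<Longrightarrow> env_step nxt ((b, V) # K1) ((b, V) # K2)"
| head: "step nxt K 0 V1 V2 \<Longrightarrow> env_step nxt ((b, V1) # K) ((b, V2) # K)"

inductive valid :: "('s \<Rightarrow> 's) \<Rightarrow> nat set \<Rightarrow> 's env \<Rightarrow> 's tm \<Rightarrow> bool"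
  for nxt :: "'s \<Rightarrow> 's" and A :: "nat set"
where
  sort: "valid nxt A L (Sort s)"
| var_0: "valid nxt A K V \<Longrightarrow> valid nxt A ((b, V) # K) (Var 0)"
| var_Suc: "valid nxt A K (Var i) \<Longrightarrow> valid nxt A ((b, V) # K) (Var (Suc i))"
| bind: "valid nxt A L V \<Longrightarrow> valid nxt A ((b, V) # L) T \<Longrightarrow> valid nxt A L (Bind b V T)"
| cast: "valid nxt A L U \<Longrightarrow> valid nxt A L T \<Longrightarrow>
    steps nxt L 1 T U0 \<Longrightarrow> steps nxt L 0 U U0 \<Longrightarrow> valid nxt A L (Cast U T)"
| app: "valid nxt A L V \<Longrightarrow> valid nxt A L T \<Longrightarrow> n \<in> A \<Longrightarrow>
    steps nxt L n T (Lambda W0 U0) \<Longrightarrow> steps nxt L 1 V W0 \<Longrightarrow> valid nxt A L (App V T)"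

end

theory Submission
  imports Defs
begin

text \<open>Preservation and confluence depend on each other, because a cast \<open>cast(U, T)\<close> steps to both
  \<open>U\<close> and \<open>T\<close>. Strong normalization, on which one could base a joint induction, is avoided as
  follows. Terms are erased to a \<open>\<lambda>\<close>-typed \<open>\<lambda>\<close>-calculus by dropping casts and unfolding
  definitions; there the \<open>1\<close>-step becomes a function, the static type. In this calculus
  \<open>\<beta>\<close>-reduction is restricted to the redexes \<open>app(v, \<lambda>w. t)\<close> in which the static type of \<open>v\<close> is
  convertible to \<open>w\<close>, where convertibility is generated by the restricted reduction itself. This
  condition is stable under substitution and reduction, so the restricted reduction is confluent on
  raw terms and respects static types. Validity is then rephrased in terms of this conversion.
  Confluence makes abstraction injective, so every redex of a valid term is admissible, which gives
  preservation. A term reduces to its erasure by \<open>0\<close>-steps, so common reducts can be read back.\<close>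

section \<open>The erased calculus\<close>

datatype 's lam = Srt 's | Idx nat | Ap "'s lam" "'s lam" | Lm "'s lam" "'s lam"

abbreviation upr :: "(nat \<Rightarrow> nat) \<Rightarrow> nat \<Rightarrow> nat" where
  "upr r \<equiv> case_nat 0 (\<lambda>i. Suc (r i))"

primrec ren :: "(nat \<Rightarrow> nat) \<Rightarrow> 's lam \<Rightarrow> 's lam" where
  "ren r (Srt s) = Srt s"
| "ren r (Idx i) = Idx (r i)"
| "ren r (Ap v t) = Ap (ren r v) (ren r t)"
| "ren r (Lm w t) = Lm (ren r w) (ren (upr r) t)"

text \<open>Substitutions are total functions on indices: \<open>Idx\<close> is the identity,
  \<open>case_nat v \<sigma>\<close> sends index 0 to \<open>v\<close>, and
  \<open>case_nat v Idx\<close> is the substitution of a beta contraction.\<close>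

abbreviation ups :: "(nat \<Rightarrow> 's lam) \<Rightarrow> nat \<Rightarrow> 's lam" where
  "ups \<sigma> \<equiv> case_nat (Idx 0) (\<lambda>i. ren Suc (\<sigma> i))"

primrec sub :: "(nat \<Rightarrow> 's lam) \<Rightarrow> 's lam \<Rightarrow> 's lam" where
  "sub \<sigma> (Srt s) = Srt s"
| "sub \<sigma> (Idx i) = \<sigma> i"
| "sub \<sigma> (Ap v t) = Ap (sub \<sigma> v) (sub \<sigma> t)"
| "sub \<sigma> (Lm w t) = Lm (sub \<sigma> w) (sub (ups \<sigma>) t)"

section \<open>Laws of renaming and parallel substitution\<close>

lemma upr_comp: "(\<lambda>i. upr r (upr q i)) = upr (\<lambda>i. r (q i))"
  by (auto split: nat.split)

lemma ren_ren: "ren r (ren q t) = ren (\<lambda>i. r (q i)) t"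
  by (induction t arbitrary: r q) (simp_all add: upr_comp)

lemma ups_upr: "(\<lambda>i. ups \<sigma> (upr q i)) = ups (\<lambda>i. \<sigma> (q i))"
  by (auto split: nat.split)

lemma sub_ren: "sub \<sigma> (ren q t) = sub (\<lambda>i. \<sigma> (q i)) t"
  by (induction t arbitrary: \<sigma> q) (simp_all add: ups_upr)

lemma ren_ups: "(\<lambda>i. ren (upr r) (ups \<sigma> i)) = ups (\<lambda>i. ren r (\<sigma> i))"
  by (auto simp: ren_ren split: nat.split)

lemma ren_sub: "ren r (sub \<sigma> t) = sub (\<lambda>i. ren r (\<sigma> i)) t"
  by (induction t arbitrary: \<sigma> r) (simp_all add: ren_ups)

lemma sub_ups: "(\<lambda>i. sub (ups \<tau>) (ups \<sigma> i)) = ups (\<lambda>i. sub \<tau> (\<sigma> i))"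
  by (auto simp: sub_ren ren_sub split: nat.split)

lemma sub_sub: "sub \<tau> (sub \<sigma> t) = sub (\<lambda>i. sub \<tau> (\<sigma> i)) t"
  by (induction t arbitrary: \<sigma> \<tau>) (simp_all add: sub_ups)

lemma ups_Idx: "case_nat (Idx 0) (\<lambda>i. Idx (Suc i)) = Idx"
  by (auto split: nat.split)

lemma sub_Idx: "sub Idx t = t"
  by (induction t) (simp_all add: ups_Idx)

lemma ups_Idx_comp: "(\<lambda>i. Idx (upr r i)) = case_nat (Idx 0) (\<lambda>i. Idx (Suc (r i)))"
  by (auto split: nat.split)

lemma ren_eq_sub: "ren r t = sub (\<lambda>i. Idx (r i)) t"
  by (induction t arbitrary: r) (simp_all add: ups_Idx_comp)

lemma sub_case_ren_Suc: "sub (case_nat v \<sigma>) (ren Suc t) = sub \<sigma> t"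
  by (simp add: sub_ren)

text \<open>Together with \<open>sub_sub_case\<close> this is the substitution lemma for beta: both
  orders of substituting become \<open>case_nat (sub \<sigma> v) \<sigma>\<close>.\<close>

lemma sub_ups_case: "sub (case_nat (sub \<sigma> v) Idx) (sub (ups \<sigma>) t) = sub (case_nat (sub \<sigma> v) \<sigma>) t"
proof -
  have "(\<lambda>i. sub (case_nat (sub \<sigma> v) Idx) (ups \<sigma> i)) = case_nat (sub \<sigma> v) \<sigma>"
    by (auto simp: sub_case_ren_Suc sub_Idx split: nat.split)
  then show ?thesis by (simp add: sub_sub)
qed

lemma sub_sub_case: "sub \<sigma> (sub (case_nat v Idx) t) = sub (case_nat (sub \<sigma> v) \<sigma>) t"
proof -
  have "(\<lambda>i. sub \<sigma> (case_nat v Idx i)) = case_nat (sub \<sigma> v) \<sigma>"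
    by (auto split: nat.split)
  then show ?thesis by (simp add: sub_sub)
qed

text \<open>A context gives the type of every index, already lifted to the whole context.\<close>

definition dec :: "(nat \<Rightarrow> 's lam) \<Rightarrow> 's lam \<Rightarrow> nat \<Rightarrow> 's lam" where
  "dec \<Gamma> w = (\<lambda>i. ren Suc (case_nat w \<Gamma> i))"

lemma dec_simps [simp]: "dec \<Gamma> w 0 = ren Suc w" "dec \<Gamma> w (Suc i) = ren Suc (\<Gamma> i)"
  by (simp_all add: dec_def)

text \<open>This is the canonical type of \<lambda>-typed calculi: it changes only the head sort or
  head index and keeps arguments and annotations. It is total on raw terms and presupposes no
  validity.\<close>

primrec ty :: "('s \<Rightarrow> 's) \<Rightarrow> (nat \<Rightarrow> 's lam) \<Rightarrow> 's lam \<Rightarrow> 's lam" where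
  "ty nxt \<Gamma> (Srt s) = Srt (nxt s)"
| "ty nxt \<Gamma> (Idx i) = \<Gamma> i"
| "ty nxt \<Gamma> (Ap v t) = Ap v (ty nxt \<Gamma> t)"
| "ty nxt \<Gamma> (Lm w t) = Lm w (ty nxt (dec \<Gamma> w) t)"

text \<open>\<open>pred\<close> is parallel reduction. Its \<open>beta\<close> condition refers to
  \<open>conv\<close>, which \<open>pred\<close> generates in turn; all occurrences are positive.
  Stating the condition up to conversion is what lets it survive reduction of either side.\<close>

inductive
  pred :: "('s \<Rightarrow> 's) \<Rightarrow> (nat \<Rightarrow> 's lam) \<Rightarrow> 's lam \<Rightarrow> 's lam \<Rightarrow> bool" and
  conv :: "('s \<Rightarrow> 's) \<Rightarrow> (nat \<Rightarrow> 's lam) \<Rightarrow> 's lam \<Rightarrow> 's lam \<Rightarrow> bool"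
  for nxt :: "'s \<Rightarrow> 's"
where
  Srt: "pred nxt \<Gamma> (Srt s) (Srt s)"
| Idx: "pred nxt \<Gamma> (Idx i) (Idx i)"
| Ap: "pred nxt \<Gamma> v v' \<Longrightarrow> pred nxt \<Gamma> t t' \<Longrightarrow> pred nxt \<Gamma> (Ap v t) (Ap v' t')"
| Lm: "pred nxt \<Gamma> w w' \<Longrightarrow> pred nxt (dec \<Gamma> w) t t' \<Longrightarrow> pred nxt \<Gamma> (Lm w t) (Lm w' t')"
| beta: "conv nxt \<Gamma> (ty nxt \<Gamma> v) w \<Longrightarrow> pred nxt \<Gamma> v v' \<Longrightarrow> pred nxt (dec \<Gamma> w) t t' \<Longrightarrow>
    pred nxt \<Gamma> (Ap v (Lm w t)) (sub (case_nat v' Idx) t')"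
| conv_pred: "pred nxt \<Gamma> t t' \<Longrightarrow> conv nxt \<Gamma> t t'"
| conv_sym: "conv nxt \<Gamma> t u \<Longrightarrow> conv nxt \<Gamma> u t"
| conv_trans: "conv nxt \<Gamma> t u \<Longrightarrow> conv nxt \<Gamma> u v \<Longrightarrow> conv nxt \<Gamma> t v"

declare conv_trans [trans]

text \<open>In a fixed context \<open>conv\<close> is the symmetric transitive closure of
  \<open>pred\<close>. The mutual rule is applied with a trivial predicate for \<open>pred\<close>,
  so that only this closure is analysed.\<close>

lemma conv_closure_induct [consumes 1, case_names pred sym trans]:
  assumes "conv nxt \<Gamma> t u"
    and "\<And>t u. pred nxt \<Gamma> t u \<Longrightarrow> P t u"
    and "\<And>t u. P t u \<Longrightarrow> P u t"
    and "\<And>t u v. P t u \<Longrightarrow> P u v \<Longrightarrow> P t v"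
  shows "P t u"
proof -
  have "\<Gamma>' = \<Gamma> \<longrightarrow> P t u" if "conv nxt \<Gamma>' t u" for \<Gamma>'
    using that
    by (induction rule: pred_conv.inducts(2)[where ?P1.0 = "\<lambda>_ _ _. True"])
      (use assms(2-4) in blast)+
  with assms(1) show ?thesis by blast
qed

lemma pred_refl: "pred nxt \<Gamma> t t"
  by (induction t arbitrary: \<Gamma>) (auto intro: pred_conv.intros)

lemma conv_refl: "conv nxt \<Gamma> t t"
  by (intro conv_pred pred_refl)

lemma conv_Ap:
  assumes "conv nxt \<Gamma> v v'" "conv nxt \<Gamma> t t'"
  shows "conv nxt \<Gamma> (Ap v t) (Ap v' t')"
proof -
  have "conv nxt \<Gamma> (Ap v t) (Ap v' t)" using assms(1)
    by (induction rule: conv_closure_induct)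
      (auto intro: conv_pred conv_sym conv_trans pred_conv.Ap pred_refl)
  also have "conv nxt \<Gamma> (Ap v' t) (Ap v' t')" using assms(2)
    by (induction rule: conv_closure_induct)
      (auto intro: conv_pred conv_sym conv_trans pred_conv.Ap pred_refl)
  finally show ?thesis .
qed

lemma conv_Lm_left:
  assumes "conv nxt \<Gamma> w w'"
  shows "conv nxt \<Gamma> (Lm w t) (Lm w' t)"
  using assms by (induction rule: conv_closure_induct)
    (auto intro: conv_pred conv_sym conv_trans pred_conv.Lm pred_refl)

lemma conv_Lm_right:
  assumes "conv nxt (dec \<Gamma> w) t t'"
  shows "conv nxt \<Gamma> (Lm w t) (Lm w t')"
  using assms by (induction rule: conv_closure_induct)
    (auto intro: conv_pred conv_sym conv_trans pred_conv.Lm pred_refl)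

section \<open>Morphisms of contexts\<close>

text \<open>A renaming carries declared types over exactly, hence an equation here; for
  substitutions \<open>ty_sub\<close> gives only a conversion.\<close>

lemma ty_ren:
  assumes "\<And>i. \<Delta> (r i) = ren r (\<Gamma> i)"
  shows "ty nxt \<Delta> (ren r t) = ren r (ty nxt \<Gamma> t)"
  using assms
proof (induction t arbitrary: r \<Gamma> \<Delta>)
  case (Lm w t)
  have "dec \<Delta> (ren r w) (upr r i) = ren (upr r) (dec \<Gamma> w i)" for i
    using Lm.prems by (cases i) (simp_all add: ren_ren)
  with Lm.IH(2) show ?case by simp
qed auto

lemma ren_beta: "ren r (sub (case_nat v Idx) t) = sub (case_nat (ren r v) Idx) (ren (upr r) t)"
proof -
  have "(\<lambda>i. ren r (case_nat v Idx i)) = (\<lambda>i. case_nat (ren r v) Idx (upr r i))"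
    by (auto split: nat.split)
  then show ?thesis by (simp add: ren_sub sub_ren)
qed

text \<open>The \<open>beta\<close> condition forces a joint induction. Renaming is treated before
  substitution because \<open>ups\<close> renames the values of a substitution.\<close>

lemma pred_conv_ren:
  shows "pred nxt \<Gamma> t t' \<Longrightarrow> (\<And>i. \<Delta> (r i) = ren r (\<Gamma> i)) \<Longrightarrow> pred nxt \<Delta> (ren r t) (ren r t')"
    and "conv nxt \<Gamma> t t' \<Longrightarrow> (\<And>i. \<Delta> (r i) = ren r (\<Gamma> i)) \<Longrightarrow> conv nxt \<Delta> (ren r t) (ren r t')"
proof (induction arbitrary: \<Delta> r and \<Delta> r rule: pred_conv.inducts)
  case (Lm \<Gamma> w w' t t')
  have "dec \<Delta> (ren r w) (upr r i) = ren (upr r) (dec \<Gamma> w i)" for i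
    using Lm.prems by (cases i) (simp_all add: ren_ren)
  with Lm show ?case by (auto intro: pred_conv.Lm)
next
  case (beta \<Gamma> v w v' t t')
  have "dec \<Delta> (ren r w) (upr r i) = ren (upr r) (dec \<Gamma> w i)" for i
    using beta.prems by (cases i) (simp_all add: ren_ren)
  moreover have "conv nxt \<Delta> (ty nxt \<Delta> (ren r v)) (ren r w)"
    using beta by (simp add: ty_ren)
  ultimately show ?case using beta by (simp add: ren_beta pred_conv.beta)
next
  case (conv_sym \<Gamma> t u)
  then show ?case by (blast intro: pred_conv.conv_sym)
next
  case (conv_trans \<Gamma> t u v)
  then show ?case by (blast intro: pred_conv.conv_trans)
qed (auto intro: pred_conv.intros)

lemma ty_dec_ren_Suc: "ty nxt (dec \<Gamma> w) (ren Suc t) = ren Suc (ty nxt \<Gamma> t)"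
  by (rule ty_ren) simp

lemma pred_ren_Suc: "pred nxt \<Gamma> t t' \<Longrightarrow> pred nxt (dec \<Gamma> w) (ren Suc t) (ren Suc t')"
  by (rule pred_conv_ren) simp_all

lemma conv_ren_Suc: "conv nxt \<Gamma> t t' \<Longrightarrow> conv nxt (dec \<Gamma> w) (ren Suc t) (ren Suc t')"
  by (rule pred_conv_ren) simp_all

text \<open>A morphism sends each index to a term whose static type agrees, up to conversion, with
  the instance of the declared type. \<open>Idx\<close> is a morphism precisely between pointwise
  convertible contexts.\<close>

definition mor :: "('s \<Rightarrow> 's) \<Rightarrow> (nat \<Rightarrow> 's lam) \<Rightarrow> (nat \<Rightarrow> 's lam) \<Rightarrow> (nat \<Rightarrow> 's lam) \<Rightarrow> bool" where
  "mor nxt \<Gamma> \<Delta> \<sigma> \<longleftrightarrow> (\<forall>i. conv nxt \<Delta> (ty nxt \<Delta> (\<sigma> i)) (sub \<sigma> (\<Gamma> i)))"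

lemma mor_ups:
  assumes "mor nxt \<Gamma> \<Delta> \<sigma>"
  shows "mor nxt (dec \<Gamma> w) (dec \<Delta> (sub \<sigma> w)) (ups \<sigma>)"
  unfolding mor_def
proof
  fix i
  show "conv nxt (dec \<Delta> (sub \<sigma> w)) (ty nxt (dec \<Delta> (sub \<sigma> w)) (ups \<sigma> i)) (sub (ups \<sigma>) (dec \<Gamma> w i))"
  proof (cases i)
    case 0
    then show ?thesis by (simp add: sub_ren ren_sub conv_refl)
  next
    case (Suc j)
    have "conv nxt \<Delta> (ty nxt \<Delta> (\<sigma> j)) (sub \<sigma> (\<Gamma> j))" using assms by (simp add: mor_def)
    from conv_ren_Suc[OF this] Suc show ?thesis
      by (simp add: sub_ren ren_sub[symmetric] ty_dec_ren_Suc)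
  qed
qed

text \<open>For \<open>\<sigma> = Idx\<close> the second hypothesis is the \<open>beta\<close>
  condition: contracting an admissible redex substitutes along a morphism.\<close>

lemma mor_case_nat:
  assumes "mor nxt \<Gamma> \<Delta> \<sigma>" "conv nxt \<Delta> (ty nxt \<Delta> v) (sub \<sigma> w)"
  shows "mor nxt (dec \<Gamma> w) \<Delta> (case_nat v \<sigma>)"
  using assms by (auto simp: mor_def dec_def sub_case_ren_Suc split: nat.split)

lemma mor_Idx: "mor nxt \<Gamma> \<Gamma> Idx"
  by (simp add: mor_def sub_Idx conv_refl)

lemma mor_Idx_Suc: "mor nxt \<Gamma> (dec \<Gamma> w) (\<lambda>i. Idx (Suc i))"
  by (simp add: mor_def ren_eq_sub[symmetric] conv_refl)

lemma mor_Idx_iff: "mor nxt \<Gamma> \<Delta> Idx \<longleftrightarrow> (\<forall>i. conv nxt \<Delta> (\<Delta> i) (\<Gamma> i))"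
  by (simp add: mor_def sub_Idx)

lemma ty_sub:
  assumes "mor nxt \<Gamma> \<Delta> \<sigma>"
  shows "conv nxt \<Delta> (ty nxt \<Delta> (sub \<sigma> t)) (sub \<sigma> (ty nxt \<Gamma> t))"
  using assms
proof (induction t arbitrary: \<Gamma> \<Delta> \<sigma>)
  case (Lm w t)
  then show ?case by (simp add: conv_Lm_right mor_ups)
qed (auto simp: conv_refl mor_def intro: conv_Ap)

text \<open>Morphisms preserve admissibility of redexes. Two substitutions occur in the first part
  so that an argument and the body receiving it can reduce in parallel.\<close>

lemma pred_conv_sub:
  shows "pred nxt \<Gamma> t t' \<Longrightarrow> mor nxt \<Gamma> \<Delta> \<sigma> \<Longrightarrow> (\<And>i. pred nxt \<Delta> (\<sigma> i) (\<sigma>' i)) \<Longrightarrow>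
      pred nxt \<Delta> (sub \<sigma> t) (sub \<sigma>' t')"
    and "conv nxt \<Gamma> t t' \<Longrightarrow> mor nxt \<Gamma> \<Delta> \<sigma> \<Longrightarrow> conv nxt \<Delta> (sub \<sigma> t) (sub \<sigma> t')"
proof (induction arbitrary: \<Delta> \<sigma> \<sigma>' and \<Delta> \<sigma> rule: pred_conv.inducts)
  case (Lm \<Gamma> w w' t t')
  have "pred nxt (dec \<Delta> (sub \<sigma> w)) (ups \<sigma> i) (ups \<sigma>' i)" for i
    using Lm.prems by (cases i) (simp_all add: pred_refl pred_ren_Suc)
  from Lm.IH(4)[OF mor_ups[OF Lm.prems(1)] this] Lm.IH(2)[OF Lm.prems]
  show ?case by (simp add: pred_conv.Lm)
next
  case (beta \<Gamma> v w v' t t')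
  have "pred nxt (dec \<Delta> (sub \<sigma> w)) (ups \<sigma> i) (ups \<sigma>' i)" for i
    using beta.prems by (cases i) (simp_all add: pred_refl pred_ren_Suc)
  then have "pred nxt (dec \<Delta> (sub \<sigma> w)) (sub (ups \<sigma>) t) (sub (ups \<sigma>') t')"
    by (rule beta.IH(6)[OF mor_ups[OF beta.prems(1)]])
  \<comment> \<open>\<open>ty_sub\<close> moves the static type under the substitution; the
    induction hypothesis for the side condition does the rest.\<close>
  moreover have "conv nxt \<Delta> (ty nxt \<Delta> (sub \<sigma> v)) (sub \<sigma> w)"
    using beta ty_sub conv_trans by blast
  ultimately have "pred nxt \<Delta> (sub \<sigma> (Ap v (Lm w t))) (sub (case_nat (sub \<sigma>' v') Idx) (sub (ups \<sigma>') t'))"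
    using beta by (simp add: pred_conv.beta)
  then show ?case by (simp add: sub_ups_case sub_sub_case)
next
  case (conv_pred \<Gamma> t t')
  then show ?case by (blast intro: pred_conv.conv_pred pred_refl)
next
  case (conv_sym \<Gamma> t u)
  then show ?case by (blast intro: pred_conv.conv_sym)
next
  case (conv_trans \<Gamma> t u v)
  then show ?case by (blast intro: pred_conv.conv_trans)
qed (auto intro: pred_conv.intros)

text \<open>This moves judgements about a body to another context when the annotation is replaced by
  a convertible one.\<close>

lemma mor_dec_Idx:
  assumes "conv nxt \<Gamma> w w'"
  shows "mor nxt (dec \<Gamma> w) (dec \<Gamma> w') Idx"
  using conv_ren_Suc[OF conv_sym[OF assms]]
  by (auto simp: mor_Idx_iff dec_def conv_refl split: nat.split)

lemma conv_mor_Idx: "conv nxt \<Gamma> t t' \<Longrightarrow> mor nxt \<Gamma> \<Delta> Idx \<Longrightarrow> conv nxt \<Delta> t t'"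
  using pred_conv_sub(2) by (fastforce simp: sub_Idx)

lemma pred_mor_Idx: "pred nxt \<Gamma> t t' \<Longrightarrow> mor nxt \<Gamma> \<Delta> Idx \<Longrightarrow> pred nxt \<Delta> t t'"
  using pred_conv_sub(1)[of nxt \<Gamma> t t' \<Delta> Idx Idx] by (simp add: sub_Idx pred_refl)

lemma conv_Lm:
  assumes "conv nxt \<Gamma> w w'" "conv nxt (dec \<Gamma> w) t t'"
  shows "conv nxt \<Gamma> (Lm w t) (Lm w' t')"
  using conv_trans[OF conv_Lm_right[OF assms(2)] conv_Lm_left[OF assms(1)]] .

text \<open>The static type of an admissible redex is a redex with the same argument and annotation,
  so it is admissible too; contracting it and applying \<open>ty_sub\<close> closes the
  \<open>beta\<close> case.\<close>

lemma ty_pred: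
  assumes "pred nxt \<Gamma> t t'"
  shows "conv nxt \<Gamma> (ty nxt \<Gamma> t) (ty nxt \<Gamma> t')"
  using assms
proof (induction rule: pred_conv.inducts(1)[where ?P2.0 = "\<lambda>_ _ _. True"])
  case (Ap \<Gamma> v v' t t')
  then show ?case by (auto intro: conv_Ap conv_pred)
next
  case (Lm \<Gamma> w w' t t')
  have ww: "conv nxt \<Gamma> w w'" by (rule conv_pred) fact
  \<comment> \<open>The static type of \<open>t'\<close> is compared in the two contexts that differ
    by \<open>w\<close> and \<open>w'\<close>.\<close>
  have "conv nxt (dec \<Gamma> w') (ty nxt (dec \<Gamma> w') t') (ty nxt (dec \<Gamma> w) t')"
    using ty_sub[OF mor_dec_Idx[OF ww]] by (simp add: sub_Idx)
  then have "conv nxt (dec \<Gamma> w) (ty nxt (dec \<Gamma> w') t') (ty nxt (dec \<Gamma> w) t')"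
    by (rule conv_mor_Idx) (rule mor_dec_Idx[OF conv_sym[OF ww]])
  then have "conv nxt (dec \<Gamma> w) (ty nxt (dec \<Gamma> w) t) (ty nxt (dec \<Gamma> w') t')"
    by (rule conv_trans[OF Lm.IH(2) conv_sym])
  with ww show ?case by (simp add: conv_Lm)
next
  case (beta \<Gamma> v w v' t t')
  let ?s = "case_nat v Idx" and ?s' = "case_nat v' Idx"
  have m: "mor nxt (dec \<Gamma> w) \<Gamma> ?s"
    using beta.hyps(1) by (auto intro!: mor_case_nat mor_Idx simp: sub_Idx)
  \<comment> \<open>The induction hypothesis for the argument transfers the side condition from
    \<open>v\<close> to \<open>v'\<close>.\<close>
  have m': "mor nxt (dec \<Gamma> w) \<Gamma> ?s'"
    using conv_trans[OF conv_sym[OF beta.IH(1)] beta.hyps(1)]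
    by (auto intro!: mor_case_nat mor_Idx simp: sub_Idx)
  have "pred nxt \<Gamma> (ty nxt \<Gamma> (Ap v (Lm w t))) (sub ?s (ty nxt (dec \<Gamma> w) t))"
    using beta by (simp add: pred_conv.beta pred_refl)
  then have "conv nxt \<Gamma> (ty nxt \<Gamma> (Ap v (Lm w t))) (sub ?s (ty nxt (dec \<Gamma> w) t))"
    by (rule conv_pred)
  also have "conv nxt \<Gamma> \<dots> (sub ?s (ty nxt (dec \<Gamma> w) t'))"
    by (rule pred_conv_sub(2)[OF beta.IH(2) m])
  also have "conv nxt \<Gamma> \<dots> (sub ?s' (ty nxt (dec \<Gamma> w) t'))"
    by (rule conv_pred, rule pred_conv_sub(1)[OF pred_refl m])
      (use beta in \<open>auto simp: pred_refl split: nat.split\<close>)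
  also have "conv nxt \<Gamma> \<dots> (ty nxt \<Gamma> (sub ?s' t'))"
    by (rule conv_sym, rule ty_sub, rule m')
  finally show ?case .
qed (auto simp: conv_refl)

lemma conv_ty_pred: "pred nxt \<Gamma> t t' \<Longrightarrow> conv nxt \<Gamma> (ty nxt \<Gamma> t) w \<Longrightarrow> conv nxt \<Gamma> (ty nxt \<Gamma> t') w"
  by (rule conv_trans[OF conv_sym[OF ty_pred]])

lemma conv_pred_right: "conv nxt \<Gamma> t w \<Longrightarrow> pred nxt \<Gamma> w w' \<Longrightarrow> conv nxt \<Gamma> t w'"
  by (rule conv_trans[OF _ conv_pred])

lemma ty_conv:
  assumes "conv nxt \<Gamma> t t'"
  shows "conv nxt \<Gamma> (ty nxt \<Gamma> t) (ty nxt \<Gamma> t')"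
  using assms
  by (induction rule: conv_closure_induct) (blast intro: ty_pred conv_sym conv_trans)+

section \<open>Iterated static types\<close>

abbreviation tys :: "('s \<Rightarrow> 's) \<Rightarrow> (nat \<Rightarrow> 's lam) \<Rightarrow> nat \<Rightarrow> 's lam \<Rightarrow> 's lam" where
  "tys nxt \<Gamma> n \<equiv> ty nxt \<Gamma> ^^ n"

lemma tys_conv: "conv nxt \<Gamma> t t' \<Longrightarrow> conv nxt \<Gamma> (tys nxt \<Gamma> n t) (tys nxt \<Gamma> n t')"
  by (induction n) (auto intro: ty_conv)

lemma tys_sub:
  assumes "mor nxt \<Gamma> \<Delta> \<sigma>"
  shows "conv nxt \<Delta> (tys nxt \<Delta> n (sub \<sigma> t)) (sub \<sigma> (tys nxt \<Gamma> n t))"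
proof (induction n)
  case (Suc n)
  then show ?case using ty_sub[OF assms] by (auto intro: ty_conv conv_trans)
qed (simp add: conv_refl)

lemma tys_Ap: "tys nxt \<Gamma> n (Ap v t) = Ap v (tys nxt \<Gamma> n t)"
  by (induction n) simp_all

lemma tys_Lm: "tys nxt \<Gamma> n (Lm w t) = Lm w (tys nxt (dec \<Gamma> w) n t)"
  by (induction n) simp_all

lemma tys_add: "tys nxt \<Gamma> (m + n) t = tys nxt \<Gamma> m (tys nxt \<Gamma> n t)"
  by (simp add: funpow_add)

lemma tys_dec_ren_Suc: "tys nxt (dec \<Gamma> w) n (ren Suc t) = ren Suc (tys nxt \<Gamma> n t)"
  by (induction n) (simp_all add: ty_dec_ren_Suc)

section \<open>Confluence of the restricted reduction\<close>

lemma pred_Lm_cases: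
  assumes "pred nxt \<Gamma> (Lm w t) z"
  obtains w' t' where "z = Lm w' t'" "pred nxt \<Gamma> w w'" "pred nxt (dec \<Gamma> w) t t'"
  using assms by (cases rule: pred.cases) auto

lemma pred_sub_beta:
  assumes "conv nxt \<Gamma> (ty nxt \<Gamma> v) w" "pred nxt \<Gamma> v v'" "pred nxt (dec \<Gamma> w) t t'"
  shows "pred nxt \<Gamma> (sub (case_nat v Idx) t) (sub (case_nat v' Idx) t')"
proof (rule pred_conv_sub(1)[OF assms(3)])
  show "mor nxt (dec \<Gamma> w) \<Gamma> (case_nat v Idx)"
    using assms by (auto intro!: mor_case_nat mor_Idx simp: sub_Idx)
qed (use assms in \<open>auto simp: pred_refl split: nat.split\<close>)

text \<open>The argument of Tait and Martin-Loef. Side conditions persist by \<open>ty_pred\<close>,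
  and reductions of a body pass to the context of a reduced annotation by
  \<open>mor_dec_Idx\<close>.\<close>

lemma pred_diamond:
  assumes "pred nxt \<Gamma> t t1" "pred nxt \<Gamma> t t2"
  shows "\<exists>z. pred nxt \<Gamma> t1 z \<and> pred nxt \<Gamma> t2 z"
  using assms
proof (induction arbitrary: t2 rule: pred_conv.inducts(1)[where ?P2.0 = "\<lambda>_ _ _. True"])
  case (Srt \<Gamma> s)
  then show ?case by (auto intro: pred_refl)
next
  case (Idx \<Gamma> i)
  then show ?case by (auto intro: pred_refl)
next
  case (Lm \<Gamma> w w1 t t1)
  from Lm.prems obtain w2 u2 where t2: "t2 = Lm w2 u2" "pred nxt \<Gamma> w w2" "pred nxt (dec \<Gamma> w) t u2"
    by (rule pred_Lm_cases)
  obtain w3 where w3: "pred nxt \<Gamma> w1 w3" "pred nxt \<Gamma> w2 w3" using Lm.IH t2 by blast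
  obtain t3 where t3: "pred nxt (dec \<Gamma> w) t1 t3" "pred nxt (dec \<Gamma> w) u2 t3" using Lm.IH t2 by blast
  have "pred nxt (dec \<Gamma> w1) t1 t3" "pred nxt (dec \<Gamma> w2) u2 t3"
    using t3 Lm.hyps t2 by (auto intro: pred_mor_Idx mor_dec_Idx conv_pred)
  with w3 t2 show ?case by (auto intro: pred_conv.Lm)
next
  case (Ap \<Gamma> v v1 t t1)
  from Ap.prems show ?case
  proof (cases rule: pred.cases)
    case (Ap v2 u2)
    with Ap.IH show ?thesis by (meson pred_conv.Ap)
  next
    case (beta w v2 u u2)
    obtain w1 u1 where t1: "t1 = Lm w1 u1" "pred nxt \<Gamma> w w1" "pred nxt (dec \<Gamma> w) u u1"
      using Ap.hyps beta by (auto elim: pred_Lm_cases)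
    obtain v3 where v3: "pred nxt \<Gamma> v1 v3" "pred nxt \<Gamma> v2 v3" using Ap.IH beta by blast
    \<comment> \<open>The induction hypothesis concerns the whole abstraction \<open>t\<close>, not
      its body \<open>u\<close>, so \<open>u2\<close> is wrapped in an abstraction again.\<close>
    have "pred nxt \<Gamma> t (Lm w u2)" using beta by (auto intro: pred_conv.Lm pred_refl)
    then obtain z where "pred nxt \<Gamma> t1 z" "pred nxt \<Gamma> (Lm w u2) z" using Ap.IH by blast
    then obtain w3 u3 where u3: "pred nxt (dec \<Gamma> w1) u1 u3" "pred nxt (dec \<Gamma> w) u2 u3"
      using t1 by (auto elim!: pred_Lm_cases)
    have "conv nxt \<Gamma> (ty nxt \<Gamma> v1) w1" "conv nxt \<Gamma> (ty nxt \<Gamma> v2) w"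
      using beta t1 Ap.hyps by (blast intro: conv_ty_pred conv_pred_right)+
    then have "pred nxt \<Gamma> (Ap v1 t1) (sub (case_nat v3 Idx) u3)" "pred nxt \<Gamma> t2 (sub (case_nat v3 Idx) u3)"
      using u3 v3 t1 beta by (simp_all add: pred_conv.beta pred_sub_beta)
    then show ?thesis by blast
  qed
next
  case (beta \<Gamma> v w v1 t t1)
  from beta.prems show ?case
  proof (cases rule: pred.cases)
    case (Ap v2 u2)
    then obtain w2 t2' where t2: "u2 = Lm w2 t2'" "pred nxt \<Gamma> w w2" "pred nxt (dec \<Gamma> w) t t2'"
      by (auto elim: pred_Lm_cases)
    obtain v3 where v3: "pred nxt \<Gamma> v1 v3" "pred nxt \<Gamma> v2 v3" using beta.IH Ap by blast
    obtain t3 where t3: "pred nxt (dec \<Gamma> w) t1 t3" "pred nxt (dec \<Gamma> w) t2' t3"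
      using beta.IH t2 by blast
    have "conv nxt \<Gamma> (ty nxt \<Gamma> v2) w2" "conv nxt \<Gamma> (ty nxt \<Gamma> v1) w"
      using beta.hyps t2 Ap by (blast intro: conv_ty_pred conv_pred_right)+
    moreover have "pred nxt (dec \<Gamma> w2) t2' t3"
      using t3 t2 by (auto intro: pred_mor_Idx mor_dec_Idx conv_pred)
    ultimately show ?thesis using Ap t2 v3 t3 by (blast intro: pred_conv.beta pred_sub_beta)
  next
    case b: (beta v2 u2)
    obtain v3 where v3: "pred nxt \<Gamma> v1 v3" "pred nxt \<Gamma> v2 v3" using beta.IH b by blast
    obtain t3 where t3: "pred nxt (dec \<Gamma> w) t1 t3" "pred nxt (dec \<Gamma> w) u2 t3"
      using beta.IH b by blast
    have "conv nxt \<Gamma> (ty nxt \<Gamma> v1) w" "conv nxt \<Gamma> (ty nxt \<Gamma> v2) w"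
      using beta.hyps b by (blast intro: conv_ty_pred)+
    then show ?thesis using b v3 t3 by (blast intro: pred_sub_beta)
  qed
qed (auto intro: pred_refl)

section \<open>From the diamond to confluence and injectivity of abstraction\<close>

abbreviation preds :: "('s \<Rightarrow> 's) \<Rightarrow> (nat \<Rightarrow> 's lam) \<Rightarrow> 's lam \<Rightarrow> 's lam \<Rightarrow> bool" where
  "preds nxt \<Gamma> \<equiv> (pred nxt \<Gamma>)\<^sup>*\<^sup>*"

lemma pred_strip:
  assumes "preds nxt \<Gamma> t t1" "pred nxt \<Gamma> t t2"
  shows "\<exists>z. pred nxt \<Gamma> t1 z \<and> preds nxt \<Gamma> t2 z"
  using assms
proof (induction)
  case (step u u')
  then show ?case by (meson pred_diamond rtranclp.rtrancl_into_rtrancl)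
qed auto

lemma preds_confluent:
  assumes "preds nxt \<Gamma> t t1" "preds nxt \<Gamma> t t2"
  shows "\<exists>z. preds nxt \<Gamma> t1 z \<and> preds nxt \<Gamma> t2 z"
  using assms(2)
proof (induction)
  case base
  then show ?case using assms by blast
next
  case (step u u')
  then obtain z where "preds nxt \<Gamma> t1 z" "preds nxt \<Gamma> u z" by blast
  moreover from pred_strip[OF this(2) step.hyps(2)] obtain z'
    where "pred nxt \<Gamma> z z'" "preds nxt \<Gamma> u' z'" by blast
  ultimately show ?case by (meson rtranclp.rtrancl_into_rtrancl)
qed

lemma conv_join:
  assumes "conv nxt \<Gamma> t u"
  obtains z where "preds nxt \<Gamma> t z" "preds nxt \<Gamma> u z"
proof -
  have "\<exists>z. preds nxt \<Gamma> t z \<and> preds nxt \<Gamma> u z"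
    using assms
  proof (induction rule: conv_closure_induct)
    case (trans t u v)
    then show ?case by (meson preds_confluent rtranclp_trans)
  qed auto
  with that show ?thesis by blast
qed

lemma preds_Lm:
  assumes "preds nxt \<Gamma> (Lm w t) z"
  shows "\<exists>w' t'. z = Lm w' t' \<and> preds nxt \<Gamma> w w'"
  using assms
proof (induction)
  case (step y z)
  then show ?case by (auto elim!: pred_Lm_cases intro: rtranclp.rtrancl_into_rtrancl)
qed auto

lemma preds_conv: "preds nxt \<Gamma> t t' \<Longrightarrow> conv nxt \<Gamma> t t'"
  by (induction rule: rtranclp_induct) (auto intro: conv_refl conv_trans conv_pred)

text \<open>An abstraction reduces only to abstractions, so a common reduct also joins the
  annotations. This is how redexes of valid terms are shown admissible.\<close>

lemma conv_Lm_inject: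
  assumes "conv nxt \<Gamma> (Lm w t) (Lm w' t')"
  shows "conv nxt \<Gamma> w w'"
proof -
  obtain z where z: "preds nxt \<Gamma> (Lm w t) z" "preds nxt \<Gamma> (Lm w' t') z"
    using assms by (rule conv_join)
  from preds_Lm[OF z(1)] preds_Lm[OF z(2)] obtain u where "preds nxt \<Gamma> w u" "preds nxt \<Gamma> w' u"
    by auto
  then show ?thesis by (meson preds_conv conv_sym conv_trans)
qed

section \<open>Erasure\<close>

text \<open>These functions treat both binder kinds uniformly: a declaration contributes a new index
  of the erased calculus, a definition only a value for its variable. \<open>bind_ren\<close> embeds
  the old indices.\<close>

definition bind_sub :: "binder_kind \<Rightarrow> 's lam \<Rightarrow> (nat \<Rightarrow> 's lam) \<Rightarrow> nat \<Rightarrow> 's lam" where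
  "bind_sub b v \<rho> = (case b of Declaration \<Rightarrow> ups \<rho> | Definition \<Rightarrow> case_nat v \<rho>)"

definition bind_ctx :: "binder_kind \<Rightarrow> 's lam \<Rightarrow> (nat \<Rightarrow> 's lam) \<Rightarrow> nat \<Rightarrow> 's lam" where
  "bind_ctx b v \<Gamma> = (case b of Declaration \<Rightarrow> dec \<Gamma> v | Definition \<Rightarrow> \<Gamma>)"

definition bind_lam :: "binder_kind \<Rightarrow> 's lam \<Rightarrow> 's lam \<Rightarrow> 's lam" where
  "bind_lam b v t = (case b of Declaration \<Rightarrow> Lm v t | Definition \<Rightarrow> t)"

definition bind_ren :: "binder_kind \<Rightarrow> nat \<Rightarrow> nat" where
  "bind_ren b = (case b of Declaration \<Rightarrow> Suc | Definition \<Rightarrow> \<lambda>i. i)"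

lemmas bind_defs = bind_sub_def bind_ctx_def bind_lam_def bind_ren_def

text \<open>Definitions, both local and in the environment, are unfolded by \<open>\<rho>\<close>, so that the indices of
  the erased term refer to the declarations only.\<close>

primrec erase :: "(nat \<Rightarrow> 's lam) \<Rightarrow> 's tm \<Rightarrow> 's lam" where
  "erase \<rho> (Sort s) = Srt s"
| "erase \<rho> (Var i) = \<rho> i"
| "erase \<rho> (App V T) = Ap (erase \<rho> V) (erase \<rho> T)"
| "erase \<rho> (Bind b V T) = bind_lam b (erase \<rho> V) (erase (bind_sub b (erase \<rho> V) \<rho>) T)"
| "erase \<rho> (Cast U T) = erase \<rho> T"

primrec interp :: "'s env \<Rightarrow> nat \<Rightarrow> 's lam" where
  "interp [] = Idx"
| "interp (e # K) = bind_sub (fst e) (erase (interp K) (snd e)) (interp K)"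

section \<open>Erasure under lifting and renaming\<close>

abbreviation skip :: "nat \<Rightarrow> nat \<Rightarrow> nat" where
  "skip k \<equiv> \<lambda>i. if i < k then i else Suc i"

lemma bind_sub_skip: "(\<lambda>i. bind_sub b v \<rho> (skip (Suc k) i)) = bind_sub b v (\<lambda>i. \<rho> (skip k i))"
  by (auto simp: bind_defs split: binder_kind.split nat.split)

lemma erase_lift: "erase \<rho> (lift k T) = erase (\<lambda>i. \<rho> (skip k i)) T"
  by (induction T arbitrary: k \<rho>) (simp_all add: bind_sub_skip[simplified])

lemma bind_sub_ren: "(\<lambda>i. ren (case b of Declaration \<Rightarrow> upr r | Definition \<Rightarrow> r) (bind_sub b v \<rho> i))
    = bind_sub b (ren r v) (\<lambda>i. ren r (\<rho> i))"
  by (auto simp: bind_defs ren_ren split: binder_kind.split nat.split)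

lemma erase_ren: "erase (\<lambda>i. ren r (\<rho> i)) T = ren r (erase \<rho> T)"
proof (induction T arbitrary: r \<rho>)
  case (Bind b V T)
  then show ?case
    by (simp add: bind_sub_ren[symmetric]) (simp add: bind_lam_def split: binder_kind.split)
qed auto

lemma bind_sub_Suc: "bind_sub b v \<rho> (Suc i) = ren (bind_ren b) (\<rho> i)"
  by (simp add: bind_defs ren_eq_sub sub_Idx split: binder_kind.split)

lemma erase_bind_lift: "erase (bind_sub b v \<rho>) (lift 0 T) = ren (bind_ren b) (erase \<rho> T)"
  by (simp add: erase_lift bind_sub_Suc erase_ren)

section \<open>Semantic validity\<close>

text \<open>This is validity with reductions replaced by conversions of erased terms, which makes it
  structurally recursive. \<open>Q\<close> marks the variables that may be used; a bound one may,
  since its entry \<open>V\<close> has just been checked.\<close>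

primrec sound :: "('s \<Rightarrow> 's) \<Rightarrow> nat set \<Rightarrow> (nat \<Rightarrow> 's lam) \<Rightarrow> (nat \<Rightarrow> 's lam) \<Rightarrow> (nat \<Rightarrow> bool) \<Rightarrow> 's tm \<Rightarrow> bool" where
  "sound nxt A \<rho> \<Gamma> Q (Sort s) \<longleftrightarrow> True"
| "sound nxt A \<rho> \<Gamma> Q (Var i) \<longleftrightarrow> Q i"
| "sound nxt A \<rho> \<Gamma> Q (App V T) \<longleftrightarrow> sound nxt A \<rho> \<Gamma> Q V \<and> sound nxt A \<rho> \<Gamma> Q T \<and>
    (\<exists>n\<in>A. \<exists>w u. conv nxt \<Gamma> (tys nxt \<Gamma> n (erase \<rho> T)) (Lm w u) \<and>
      conv nxt \<Gamma> (ty nxt \<Gamma> (erase \<rho> V)) w)"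
| "sound nxt A \<rho> \<Gamma> Q (Bind b V T) \<longleftrightarrow> sound nxt A \<rho> \<Gamma> Q V \<and>
    sound nxt A (bind_sub b (erase \<rho> V) \<rho>) (bind_ctx b (erase \<rho> V) \<Gamma>) (case_nat True Q) T"
| "sound nxt A \<rho> \<Gamma> Q (Cast U T) \<longleftrightarrow> sound nxt A \<rho> \<Gamma> Q U \<and> sound nxt A \<rho> \<Gamma> Q T \<and>
    conv nxt \<Gamma> (ty nxt \<Gamma> (erase \<rho> T)) (erase \<rho> U)"

lemma case_nat_skip: "(\<lambda>i. case_nat x Q (skip (Suc k) i)) = case_nat x (\<lambda>i. Q (skip k i))"
  by (auto split: nat.split)

lemma sound_lift: "sound nxt A \<rho> \<Gamma> Q (lift k T) \<longleftrightarrow> sound nxt A (\<lambda>i. \<rho> (skip k i)) \<Gamma> (\<lambda>i. Q (skip k i)) T"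
  by (induction T arbitrary: k \<rho> \<Gamma> Q)
    (simp_all add: erase_lift bind_sub_skip[simplified] case_nat_skip[simplified])

text \<open>The new interpretation \<open>\<rho>'\<close> has to agree with \<open>\<rho>\<close>
  followed by \<open>\<sigma>\<close> only on \<open>Q\<close> and only up to conversion. One
  induction thus covers beta, weakening, and reduction of bound or environment entries.\<close>

lemma erase_sound_mor:
  assumes "sound nxt A \<rho> \<Gamma> Q T" "mor nxt \<Gamma> \<Delta> \<sigma>" "\<And>i. Q i \<Longrightarrow> conv nxt \<Delta> (\<rho>' i) (sub \<sigma> (\<rho> i))"
  shows "conv nxt \<Delta> (erase \<rho>' T) (sub \<sigma> (erase \<rho> T)) \<and> sound nxt A \<rho>' \<Delta> Q T"
  using assms
proof (induction T arbitrary: \<rho> \<rho>' \<Gamma> \<Delta> Q \<sigma>)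
  case (Sort s)
  then show ?case by (simp add: conv_refl)
next
  case (Var i)
  then show ?case by simp
next
  case (App V T)
  have V: "conv nxt \<Delta> (erase \<rho>' V) (sub \<sigma> (erase \<rho> V))" "sound nxt A \<rho>' \<Delta> Q V"
    using App.IH(1)[OF _ App.prems(2,3)] App.prems(1) by auto
  have T: "conv nxt \<Delta> (erase \<rho>' T) (sub \<sigma> (erase \<rho> T))" "sound nxt A \<rho>' \<Delta> Q T"
    using App.IH(2)[OF _ App.prems(2,3)] App.prems(1) by auto
  obtain n w u where n: "n \<in> A" "conv nxt \<Gamma> (tys nxt \<Gamma> n (erase \<rho> T)) (Lm w u)"
      "conv nxt \<Gamma> (ty nxt \<Gamma> (erase \<rho> V)) w"
    using App.prems by auto
  have "conv nxt \<Delta> (tys nxt \<Delta> n (erase \<rho>' T)) (tys nxt \<Delta> n (sub \<sigma> (erase \<rho> T)))"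
    by (rule tys_conv) fact
  also have "conv nxt \<Delta> \<dots> (sub \<sigma> (tys nxt \<Gamma> n (erase \<rho> T)))"
    by (rule tys_sub) fact
  also have "conv nxt \<Delta> \<dots> (sub \<sigma> (Lm w u))"
    using n App.prems pred_conv_sub(2) by blast
  finally have "conv nxt \<Delta> (tys nxt \<Delta> n (erase \<rho>' T)) (Lm (sub \<sigma> w) (sub (ups \<sigma>) u))" by simp
  moreover have "conv nxt \<Delta> (ty nxt \<Delta> (erase \<rho>' V)) (sub \<sigma> w)"
    using V(1) n(3) App.prems(2) by (meson ty_conv ty_sub pred_conv_sub(2) conv_trans)
  ultimately show ?case using V T n(1) by (auto intro: conv_Ap)
next
  case (Bind b V T)
  have V: "conv nxt \<Delta> (erase \<rho>' V) (sub \<sigma> (erase \<rho> V))" "sound nxt A \<rho>' \<Delta> Q V"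
    using Bind.IH(1)[OF _ Bind.prems(2,3)] Bind.prems(1) by auto
  show ?case
  proof (cases b)
    case Declaration
    let ?w = "erase \<rho> V" and ?w' = "erase \<rho>' V"
    \<comment> \<open>\<open>mor_ups\<close> ends in the context with annotation
      \<open>sub \<sigma> ?w\<close>; this is convertible to \<open>?w'\<close>, so the identity
      morphism bridges the gap.\<close>
    have "mor nxt (dec \<Gamma> ?w) (dec \<Delta> ?w') (ups \<sigma>)"
      unfolding mor_def
    proof
      fix i
      have "conv nxt (dec \<Delta> (sub \<sigma> ?w)) (ty nxt (dec \<Delta> (sub \<sigma> ?w)) (ups \<sigma> i)) (sub (ups \<sigma>) (dec \<Gamma> ?w i))"
        using mor_ups[OF Bind.prems(2)] by (simp add: mor_def)
      moreover have m: "mor nxt (dec \<Delta> (sub \<sigma> ?w)) (dec \<Delta> ?w') Idx"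
        by (rule mor_dec_Idx[OF conv_sym[OF V(1)]])
      ultimately have "conv nxt (dec \<Delta> ?w') (ty nxt (dec \<Delta> (sub \<sigma> ?w)) (ups \<sigma> i)) (sub (ups \<sigma>) (dec \<Gamma> ?w i))"
        by (rule conv_mor_Idx)
      moreover have "conv nxt (dec \<Delta> ?w') (ty nxt (dec \<Delta> ?w') (ups \<sigma> i)) (ty nxt (dec \<Delta> (sub \<sigma> ?w)) (ups \<sigma> i))"
        using ty_sub[OF m] by (simp add: sub_Idx)
      ultimately show "conv nxt (dec \<Delta> ?w') (ty nxt (dec \<Delta> ?w') (ups \<sigma> i)) (sub (ups \<sigma>) (dec \<Gamma> ?w i))"
        using conv_trans by blast
    qed
    moreover have "conv nxt (dec \<Delta> ?w') (ups \<rho>' i) (sub (ups \<sigma>) (ups \<rho> i))" if "case_nat True Q i" for i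
      using that conv_ren_Suc[OF Bind.prems(3)]
      by (cases i) (auto simp: conv_refl sub_ren ren_sub)
    moreover have "sound nxt A (ups \<rho>) (dec \<Gamma> ?w) (case_nat True Q) T"
      using Bind.prems Declaration by (simp add: bind_defs)
    ultimately have "conv nxt (dec \<Delta> ?w') (erase (ups \<rho>') T) (sub (ups \<sigma>) (erase (ups \<rho>) T)) \<and>
        sound nxt A (ups \<rho>') (dec \<Delta> ?w') (case_nat True Q) T"
      using Bind.IH(2) by blast
    with V Declaration show ?thesis by (auto simp: bind_defs intro: conv_Lm)
  next
    case Definition
    have "conv nxt \<Delta> (case_nat (erase \<rho>' V) \<rho>' i) (sub \<sigma> (case_nat (erase \<rho> V) \<rho> i))" if "case_nat True Q i" for i
      using that V Bind.prems(3) by (cases i) auto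
    moreover have "sound nxt A (case_nat (erase \<rho> V) \<rho>) \<Gamma> (case_nat True Q) T"
      using Bind.prems Definition by (simp add: bind_defs)
    ultimately show ?thesis using Bind.IH(2)[OF _ Bind.prems(2)] V Definition by (simp add: bind_defs)
  qed
next
  case (Cast U T)
  have U: "conv nxt \<Delta> (erase \<rho>' U) (sub \<sigma> (erase \<rho> U))" "sound nxt A \<rho>' \<Delta> Q U"
    using Cast.IH(1)[OF _ Cast.prems(2,3)] Cast.prems(1) by auto
  have T: "conv nxt \<Delta> (erase \<rho>' T) (sub \<sigma> (erase \<rho> T))" "sound nxt A \<rho>' \<Delta> Q T"
    using Cast.IH(2)[OF _ Cast.prems(2,3)] Cast.prems(1) by auto
  have "conv nxt \<Gamma> (ty nxt \<Gamma> (erase \<rho> T)) (erase \<rho> U)" using Cast.prems by simp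
  then have "conv nxt \<Delta> (ty nxt \<Delta> (erase \<rho>' T)) (erase \<rho>' U)"
    using U(1) T(1) Cast.prems(2) by (meson ty_conv ty_sub pred_conv_sub(2) conv_trans conv_sym)
  with U T show ?case by simp
qed

lemma sound_bind_lift:
  assumes "sound nxt A \<rho> \<Gamma> Q T"
  shows "sound nxt A (bind_sub b u \<rho>) (bind_ctx b v \<Gamma>) (case_nat q Q) (lift 0 T)"
proof -
  have "sound nxt A (\<lambda>i. ren (bind_ren b) (\<rho> i)) (bind_ctx b v \<Gamma>) Q T"
  proof (cases b)
    case Declaration
    have "sound nxt A (\<lambda>i. ren Suc (\<rho> i)) (dec \<Gamma> v) Q T"
      using erase_sound_mor[OF assms mor_Idx_Suc] by (simp add: ren_eq_sub[symmetric] conv_refl)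
    with Declaration show ?thesis by (simp add: bind_defs)
  next
    case Definition
    with assms show ?thesis by (simp add: bind_defs ren_eq_sub sub_Idx)
  qed
  then show ?thesis by (simp add: sound_lift bind_sub_Suc)
qed

lemma tys_bind_ren: "tys nxt (bind_ctx b v \<Gamma>) n (ren (bind_ren b) t) = ren (bind_ren b) (tys nxt \<Gamma> n t)"
  by (auto simp: bind_defs tys_dec_ren_Suc ren_eq_sub sub_Idx split: binder_kind.split)
    (metis ren_eq_sub tys_dec_ren_Suc)

lemma conv_bind_ren:
  "conv nxt \<Gamma> t t' \<Longrightarrow> conv nxt (bind_ctx b v \<Gamma>) (ren (bind_ren b) t) (ren (bind_ren b) t')"
  by (cases b) (auto simp: bind_defs conv_ren_Suc ren_eq_sub[of "\<lambda>i. i"] sub_Idx)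

text \<open>Entries with \<open>Q i\<close> false are never used by a valid term; nothing is known about their types, which
  are therefore left arbitrary.\<close>

inductive okctx :: "('s \<Rightarrow> 's) \<Rightarrow> nat set \<Rightarrow> 's env \<Rightarrow> (nat \<Rightarrow> 's lam) \<Rightarrow> (nat \<Rightarrow> bool) \<Rightarrow> bool"
  for nxt :: "'s \<Rightarrow> 's" and A :: "nat set"
where
  nil: "okctx nxt A [] \<Gamma> (\<lambda>_. False)"
| used: "okctx nxt A K \<Gamma> Q \<Longrightarrow> sound nxt A (interp K) \<Gamma> Q V \<Longrightarrow>
    okctx nxt A ((b, V) # K) (bind_ctx b (erase (interp K) V) \<Gamma>) (case_nat True Q)"
| unused: "okctx nxt A K \<Gamma> Q \<Longrightarrow> okctx nxt A ((b, V) # K) (bind_ctx b v \<Gamma>) (case_nat False Q)"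

text \<open>Semantic preservation: a step of degree \<open>n\<close> computes, up to conversion, the
  \<open>n\<close>-fold static type of the erasure.\<close>

lemma sound_step:
  assumes "step nxt L n T T'" "okctx nxt A L \<Gamma> Q" "sound nxt A (interp L) \<Gamma> Q T"
  shows "sound nxt A (interp L) \<Gamma> Q T' \<and>
    conv nxt \<Gamma> (tys nxt \<Gamma> n (erase (interp L) T)) (erase (interp L) T')"
  using assms
proof (induction arbitrary: \<Gamma> Q)
  case (beta L V W T)
  let ?\<rho> = "interp L" and ?v = "erase (interp L) V" and ?w = "erase (interp L) W"
  from beta.prems obtain n w u where
    n: "conv nxt \<Gamma> (tys nxt \<Gamma> n (Lm ?w (erase (ups ?\<rho>) T))) (Lm w u)" "conv nxt \<Gamma> (ty nxt \<Gamma> ?v) w"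
    by (auto simp: bind_defs)
  \<comment> \<open>Static types keep the annotation of an abstraction, so injectivity identifies
    \<open>w\<close> with \<open>?w\<close> whatever the degree \<open>n\<close>: the redex is
    admissible.\<close>
  then have vw: "conv nxt \<Gamma> (ty nxt \<Gamma> ?v) ?w"
    by (auto simp: tys_Lm dest: conv_Lm_inject intro: conv_trans conv_sym)
  have m: "mor nxt (dec \<Gamma> ?w) \<Gamma> (case_nat ?v Idx)"
    using vw by (auto intro!: mor_case_nat mor_Idx simp: sub_Idx)
  have "conv nxt \<Gamma> (case_nat ?v ?\<rho> i) (sub (case_nat ?v Idx) (ups ?\<rho> i))" for i
    by (cases i) (simp_all add: sub_case_ren_Suc sub_Idx conv_refl)
  from erase_sound_mor[where A=A and Q="case_nat True Q" and T=T, OF _ m this] beta.prems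
  have T: "conv nxt \<Gamma> (erase (case_nat ?v ?\<rho>) T) (sub (case_nat ?v Idx) (erase (ups ?\<rho>) T))"
    "sound nxt A (case_nat ?v ?\<rho>) \<Gamma> (case_nat True Q) T"
    by (auto simp: bind_defs)
  have "pred nxt \<Gamma> (Ap ?v (Lm ?w (erase (ups ?\<rho>) T))) (sub (case_nat ?v Idx) (erase (ups ?\<rho>) T))"
    by (intro pred_conv.beta vw pred_refl)
  with T have "conv nxt \<Gamma> (Ap ?v (Lm ?w (erase (ups ?\<rho>) T))) (erase (case_nat ?v ?\<rho>) T)"
    by (meson conv_pred conv_sym conv_trans)
  then show ?case using beta.prems T vw by (simp add: bind_defs)
next
  case (delta V K)
  from delta.prems show ?case
    by (cases rule: okctx.cases)
      (auto intro: sound_bind_lift simp: erase_bind_lift, 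
        simp add: bind_defs ren_eq_sub sub_Idx conv_refl)
next
  case (zeta L V T)
  then show ?case
    by (simp add: bind_defs sound_lift erase_lift conv_refl)
next
  case (theta L V W T)
  \<comment> \<open>A definition adds no index, so moving \<open>V\<close> below it leaves the
    erasure of \<open>V\<close> unchanged.\<close>
  have "erase (bind_sub Definition (erase (interp L) W) (interp L)) (lift 0 V) = erase (interp L) V"
    by (simp add: erase_bind_lift) (simp add: bind_ren_def ren_eq_sub sub_Idx)
  moreover have "sound nxt A (bind_sub Definition (erase (interp L) W) (interp L))
      (bind_ctx Definition (erase (interp L) W) \<Gamma>) (case_nat True Q) (lift 0 V)"
    using theta.prems by (simp add: sound_bind_lift)
  ultimately show ?case using theta.prems
    by (auto simp: bind_defs conv_refl)
next
  case (eps L U T)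
  then show ?case by (simp add: conv_refl)
next
  case (sort L s)
  then show ?case by (simp add: conv_refl)
next
  case (decl W K)
  from decl.prems show ?case
    by (cases rule: okctx.cases)
      (auto intro: sound_bind_lift simp: erase_bind_lift,
        simp add: bind_defs conv_refl)
next
  \<comment> \<open>The required conversion is the cast condition of \<open>sound\<close>.\<close>
  case (cast_type L U T)
  then show ?case by simp
next
  case (var_Suc K n i T b V)
  from var_Suc.prems obtain \<Gamma>' Q' q v where
    "\<Gamma> = bind_ctx b v \<Gamma>'" "Q = case_nat q Q'" "okctx nxt A K \<Gamma>' Q'" "Q' i"
    by (cases rule: okctx.cases) auto
  with var_Suc.IH[of \<Gamma>' Q'] show ?case
    by (simp add: sound_bind_lift erase_bind_lift bind_sub_Suc tys_bind_ren conv_bind_ren)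
next
  case (app_left L V1 V2 T)
  then obtain n w u where n: "n \<in> A" "conv nxt \<Gamma> (tys nxt \<Gamma> n (erase (interp L) T)) (Lm w u)"
    "conv nxt \<Gamma> (ty nxt \<Gamma> (erase (interp L) V1)) w"
    by auto
  have V: "sound nxt A (interp L) \<Gamma> Q V2" "conv nxt \<Gamma> (erase (interp L) V1) (erase (interp L) V2)"
    using app_left by auto
  have "conv nxt \<Gamma> (ty nxt \<Gamma> (erase (interp L) V2)) w"
    using n V by (meson ty_conv conv_sym conv_trans)
  with n V app_left.prems show ?case by (auto intro: conv_Ap conv_refl)
next
  case (app_right L n T1 T2 V)
  then obtain m w u where m: "m \<in> A" "conv nxt \<Gamma> (tys nxt \<Gamma> m (erase (interp L) T1)) (Lm w u)"
    "conv nxt \<Gamma> (ty nxt \<Gamma> (erase (interp L) V)) w"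
    by auto
  have T: "sound nxt A (interp L) \<Gamma> Q T2"
    "conv nxt \<Gamma> (tys nxt \<Gamma> n (erase (interp L) T1)) (erase (interp L) T2)"
    using app_right by auto
  have "conv nxt \<Gamma> (tys nxt \<Gamma> m (erase (interp L) T2)) (tys nxt \<Gamma> (m + n) (erase (interp L) T1))"
    unfolding tys_add by (rule tys_conv[OF conv_sym[OF T(2)]])
  \<comment> \<open>The abstraction reached at degree \<open>m\<close> is typed \<open>n\<close>
    further times; iterates commute and keep its annotation \<open>w\<close>.\<close>
  also have "tys nxt \<Gamma> (m + n) (erase (interp L) T1) = tys nxt \<Gamma> n (tys nxt \<Gamma> m (erase (interp L) T1))"
    by (simp add: add.commute tys_add[symmetric])
  also have "conv nxt \<Gamma> \<dots> (tys nxt \<Gamma> n (Lm w u))"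
    by (intro tys_conv m)
  finally have "conv nxt \<Gamma> (tys nxt \<Gamma> m (erase (interp L) T2)) (Lm w (tys nxt (dec \<Gamma> w) n u))"
    by (simp add: tys_Lm)
  with m T app_right.prems show ?case by (auto intro!: conv_Ap conv_refl simp: tys_Ap)
next
  case (bind_left L V1 V2 b T)
  have V: "sound nxt A (interp L) \<Gamma> Q V2" "conv nxt \<Gamma> (erase (interp L) V1) (erase (interp L) V2)"
    using bind_left by auto
  let ?\<rho> = "\<lambda>V. bind_sub b (erase (interp L) V) (interp L)"
  let ?\<Gamma> = "\<lambda>V. bind_ctx b (erase (interp L) V) \<Gamma>"
  \<comment> \<open>The context changes for a declaration, the interpretation for a definition; the
    identity morphism covers both.\<close>
  have m: "mor nxt (?\<Gamma> V1) (?\<Gamma> V2) Idx"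
    using mor_dec_Idx[OF V(2)] by (auto simp: bind_defs mor_Idx split: binder_kind.split)
  have r: "conv nxt (?\<Gamma> V2) (?\<rho> V2 i) (sub Idx (?\<rho> V1 i))" for i
    using conv_sym[OF V(2)]
    by (auto simp: bind_defs conv_refl sub_Idx split: binder_kind.split nat.split)
  have T: "conv nxt (?\<Gamma> V2) (erase (?\<rho> V2) T) (erase (?\<rho> V1) T)"
    "sound nxt A (?\<rho> V2) (?\<Gamma> V2) (case_nat True Q) T"
    using erase_sound_mor[where A=A and Q="case_nat True Q" and T=T, OF _ m r] bind_left.prems by (auto simp: sub_Idx)
  have "conv nxt \<Gamma> (bind_lam b (erase (interp L) V2) (erase (?\<rho> V2) T))
      (bind_lam b (erase (interp L) V1) (erase (?\<rho> V1) T))"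
    using T(1) conv_sym[OF V(2)] by (cases b) (auto simp: bind_defs intro: conv_Lm)
  with T V show ?case by (auto intro: conv_sym)
next
  case (bind_right b V L n T1 T2)
  have "okctx nxt A ((b, V) # L) (bind_ctx b (erase (interp L) V) \<Gamma>) (case_nat True Q)"
    using bind_right.prems by (auto intro: okctx.used)
  from bind_right.IH[OF this] bind_right.prems show ?case
    by (cases b) (auto simp: bind_defs tys_Lm intro: conv_Lm_right)
next
  case (cast_left L U1 U2 T)
  have "sound nxt A (interp L) \<Gamma> Q U2" "conv nxt \<Gamma> (erase (interp L) U1) (erase (interp L) U2)"
    using cast_left by auto
  with cast_left.prems show ?case by (auto intro: conv_refl conv_trans)
next
  case (cast_right L T1 T2 U)
  have T: "sound nxt A (interp L) \<Gamma> Q T2" "conv nxt \<Gamma> (erase (interp L) T1) (erase (interp L) T2)"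
    using cast_right by auto
  with cast_right.prems have "conv nxt \<Gamma> (ty nxt \<Gamma> (erase (interp L) T2)) (erase (interp L) U)"
    by (auto intro: ty_conv conv_sym conv_trans)
  with cast_right.prems T show ?case by simp
next
  case (cast_both L U1 U2 T1 T2)
  have U: "sound nxt A (interp L) \<Gamma> Q U2"
    "conv nxt \<Gamma> (ty nxt \<Gamma> (erase (interp L) U1)) (erase (interp L) U2)"
    using cast_both.IH(1)[of \<Gamma> Q] cast_both.prems by auto
  have T: "sound nxt A (interp L) \<Gamma> Q T2"
    "conv nxt \<Gamma> (ty nxt \<Gamma> (erase (interp L) T1)) (erase (interp L) T2)"
    using cast_both.IH(2)[of \<Gamma> Q] cast_both.prems by auto
  have "conv nxt \<Gamma> (ty nxt \<Gamma> (erase (interp L) T1)) (erase (interp L) U1)"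
    using cast_both.prems by simp
  then have "conv nxt \<Gamma> (ty nxt \<Gamma> (erase (interp L) T2)) (erase (interp L) U2)"
    using U T by (meson ty_conv conv_sym conv_trans)
  with U T show ?case by simp
qed

lemma sound_steps:
  assumes "steps nxt L n T T'" "okctx nxt A L \<Gamma> Q" "sound nxt A (interp L) \<Gamma> Q T"
  shows "sound nxt A (interp L) \<Gamma> Q T' \<and>
    conv nxt \<Gamma> (tys nxt \<Gamma> n (erase (interp L) T)) (erase (interp L) T')"
  using assms
proof (induction)
  case (trans L n1 T1 T n2 T2)
  have "conv nxt \<Gamma> (tys nxt \<Gamma> (n2 + n1) (erase (interp L) T1)) (tys nxt \<Gamma> n2 (erase (interp L) T))"
    unfolding tys_add using trans by (intro tys_conv) blast
  with trans show ?case by (auto simp: add.commute intro: conv_trans)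
qed (auto intro: conv_refl dest: sound_step)

section \<open>Reading erased terms back\<close>

lemma steps_app_left:
  assumes "steps nxt L 0 V1 V2"
  shows "steps nxt L 0 (App V1 T) (App V2 T)"
proof -
  \<comment> \<open>The degree is generalised for the induction; a sum \<open>n1 + n2 = 0\<close>
    makes both parts of a transitive step have degree 0.\<close>
  have "n = 0 \<longrightarrow> steps nxt L 0 (App V1 T) (App V2 T)" if "steps nxt L n V1 V2" for n
    using that by induction (auto intro: steps.refl steps.single step.app_left dest: steps.trans)
  with assms show ?thesis by blast
qed

lemma steps_app_right: "steps nxt L n T1 T2 \<Longrightarrow> steps nxt L n (App V T1) (App V T2)"
  by (induction rule: steps.induct) (auto intro: steps.intros step.app_right)

lemma steps_trans0: "steps nxt L 0 T1 T2 \<Longrightarrow> steps nxt L n T2 T3 \<Longrightarrow> steps nxt L n T1 T3"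
  using steps.trans by fastforce

lemma steps_trans0': "steps nxt L n T1 T2 \<Longrightarrow> steps nxt L 0 T2 T3 \<Longrightarrow> steps nxt L n T1 T3"
  using steps.trans by fastforce

lemma steps_App: "steps nxt L 0 V1 V2 \<Longrightarrow> steps nxt L n T1 T2 \<Longrightarrow> steps nxt L n (App V1 T1) (App V2 T2)"
  by (rule steps_trans0[OF steps_app_left steps_app_right])

lemma steps_bind_left:
  assumes "steps nxt L 0 V1 V2"
  shows "steps nxt L 0 (Bind b V1 T) (Bind b V2 T)"
proof -
  have "n = 0 \<longrightarrow> steps nxt L 0 (Bind b V1 T) (Bind b V2 T)" if "steps nxt L n V1 V2" for n
    using that by induction (auto intro: steps.refl steps.single step.bind_left dest: steps.trans)
  with assms show ?thesis by blast
qed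

lemma steps_bind_right:
  assumes "steps nxt ((b, V) # L) n T1 T2"
  shows "steps nxt L n (Bind b V T1) (Bind b V T2)"
proof -
  have "K = (b, V) # L \<longrightarrow> steps nxt L n (Bind b V T1) (Bind b V T2)" if "steps nxt K n T1 T2" for K
    using that by induction (auto intro: steps.intros step.bind_right)
  with assms show ?thesis by blast
qed

lemma steps_Bind: "steps nxt L 0 V1 V2 \<Longrightarrow> steps nxt ((b, V1) # L) n T1 T2 \<Longrightarrow>
    steps nxt L n (Bind b V1 T1) (Bind b V2 T2)"
  by (rule steps_trans0'[OF steps_bind_right steps_bind_left])

section \<open>Weakening of reduction\<close>

lemma lift_lift: "j \<le> k \<Longrightarrow> lift (Suc k) (lift j T) = lift j (lift k T)"
  by (induction T arbitrary: j k) auto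

text \<open>The entry \<open>e\<close> goes below the \<open>k\<close> most recent ones, and each of
  these is lifted at its own depth. The middle clause is a default outside the range
  \<open>k \<le> length L\<close> of \<open>step_lift\<close>.\<close>

fun ins :: "nat \<Rightarrow> binder_kind \<times> 's tm \<Rightarrow> 's env \<Rightarrow> 's env" where
  "ins 0 e L = e # L"
| "ins (Suc k) e [] = [e]"
| "ins (Suc k) e ((c, W) # K) = (c, lift k W) # ins k e K"

lemma step_lift:
  assumes "step nxt L n T T'" "k \<le> length L"
  shows "step nxt (ins k e L) n (lift k T) (lift k T')"
  using assms
proof (induction arbitrary: k)
  case (delta V K)
  show ?case
  proof (cases k)
    case 0
    then show ?thesis
      using step.var_Suc[OF step.delta, of nxt "fst e" "snd e" V K] by simp
  next
    case (Suc j)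
    then show ?thesis using step.delta[of nxt "lift j V" "ins j e K"] by (simp add: lift_lift)
  qed
next
  case (decl W K)
  show ?case
  proof (cases k)
    case 0
    then show ?thesis
      using step.var_Suc[OF step.decl, of nxt "fst e" "snd e" W K] by simp
  next
    case (Suc j)
    then show ?thesis using step.decl[of nxt "lift j W" "ins j e K"] by (simp add: lift_lift)
  qed
next
  case (var_Suc K n i T b V)
  show ?case
  proof (cases k)
    case 0
    then show ?thesis
      using step.var_Suc[OF step.var_Suc[OF var_Suc.hyps(1)], of "fst e" "snd e" b V] by simp
  next
    case (Suc j)
    have "step nxt (ins j e K) n (Var (skip j i)) (lift j T)"
      using var_Suc.IH[of j] var_Suc.prems Suc by simp
    from step.var_Suc[OF this, of b "lift j V"] show ?thesis
      using Suc by (auto simp: lift_lift split: if_splits)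
  qed
next
  case (zeta L V T)
  then show ?case using step.zeta[of nxt _ "lift k V" "lift k T"] by (simp add: lift_lift)
next
  case (theta L V W T)
  then show ?case by (simp add: lift_lift step.theta)
next
  case (bind_right b V L n T1 T2)
  from bind_right.IH[of "Suc k"] bind_right.prems show ?case by (simp add: step.bind_right)
qed (auto intro: step.intros[unfolded One_nat_def])

lemma steps_lift:
  assumes "steps nxt L n T T'"
  shows "steps nxt (e # L) n (lift 0 T) (lift 0 T')"
  using assms
proof (induction)
  case (single L n T1 T2)
  from step_lift[OF this, of 0 e] show ?case by (auto intro: steps.single)
qed (auto intro: steps.intros)

text \<open>With \<open>r = decls L\<close> this is a section of erasure: erasing the quoted term in
  \<open>L\<close> gives the original term back, by \<open>erase_quote\<close> and
  \<open>interp_decls\<close>.\<close>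

primrec quote :: "(nat \<Rightarrow> nat) \<Rightarrow> 's lam \<Rightarrow> 's tm" where
  "quote r (Srt s) = Sort s"
| "quote r (Idx i) = Var (r i)"
| "quote r (Ap v t) = App (quote r v) (quote r t)"
| "quote r (Lm w t) = Lambda (quote r w) (quote (upr r) t)"

text \<open>The positions of the declarations of an environment, which are the entries that survive
  erasure.\<close>

primrec decls :: "'s env \<Rightarrow> nat \<Rightarrow> nat" where
  "decls [] = (\<lambda>i. i)"
| "decls (e # K) = (case fst e of Declaration \<Rightarrow> upr (decls K) | Definition \<Rightarrow> \<lambda>i. Suc (decls K i))"

lemma skip_upr: "(\<lambda>i. skip (Suc k) (upr r i)) = upr (\<lambda>i. skip k (r i))"
  by (auto split: nat.split)

lemma lift_quote: "lift k (quote r t) = quote (\<lambda>i. skip k (r i)) t"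
  by (induction t arbitrary: k r) (simp_all add: skip_upr[simplified])

lemma quote_ren: "quote r (ren q t) = quote (\<lambda>i. r (q i)) t"
  by (induction t arbitrary: r q) (simp_all add: upr_comp)

lemma erase_quote: "erase \<rho> (quote r t) = sub (\<lambda>i. \<rho> (r i)) t"
  by (induction t arbitrary: \<rho> r) (simp_all add: bind_defs ups_upr)

lemma interp_decls: "interp L (decls L i) = Idx i"
proof (induction L arbitrary: i)
  case (Cons e L)
  then show ?case by (cases "fst e"; cases i) (simp_all add: bind_defs)
qed simp

lemma quote_decls_ren: "quote (decls ((b, V) # K)) (ren (bind_ren b) t) = lift 0 (quote (decls K) t)"
  by (cases b) (simp_all add: bind_ren_def lift_quote quote_ren)

lemma steps_Var_Cons:
  assumes "\<And>i. steps nxt K 0 (Var i) (quote (decls K) (interp K i))"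
    and "steps nxt K 0 V (quote (decls K) (erase (interp K) V))"
  shows "steps nxt ((b, V) # K) 0 (Var i) (quote (decls ((b, V) # K)) (interp ((b, V) # K) i))"
proof (cases i)
  case 0
  show ?thesis
  proof (cases b)
    case Declaration
    with 0 show ?thesis by (simp add: bind_defs steps.refl)
  next
    case Definition
    have "steps nxt ((Definition, V) # K) 0 (Var 0) (lift 0 V)"
      by (intro steps.single step.delta)
    with steps_lift[OF assms(2)] 0 Definition show ?thesis
      by (auto simp: bind_defs lift_quote intro: steps_trans0)
  qed
next
  case (Suc j)
  have "interp ((b, V) # K) (Suc j) = ren (bind_ren b) (interp K j)" by (simp add: bind_sub_Suc)
  with steps_lift[OF assms(1)[of j], of "(b, V)"] Suc show ?thesis
    by (simp only: quote_decls_ren lift.simps) simp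
qed

text \<open>The variable case is a hypothesis: it requires induction on the environment, whose
  entries in turn require the claim for terms.\<close>

lemma steps_quote_erase_aux:
  assumes "\<And>i. steps nxt L 0 (Var i) (quote (decls L) (interp L i))"
  shows "steps nxt L 0 T (quote (decls L) (erase (interp L) T))"
  using assms
proof (induction T arbitrary: L)
  case (Sort s)
  then show ?case by (simp add: steps.refl)
next
  case (App V T)
  from App.IH[OF App.prems] show ?case
    by (simp add: steps_App)
next
  case (Bind b V T)
  have V: "steps nxt L 0 V (quote (decls L) (erase (interp L) V))" by (intro Bind)
  have "steps nxt ((b, V) # L) 0 T (quote (decls ((b, V) # L)) (erase (interp ((b, V) # L)) T))"
    by (rule Bind.IH, rule steps_Var_Cons) (intro Bind V)+
  then have T: "steps nxt L 0 (Bind b V T)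
      (Bind b V (quote (decls ((b, V) # L)) (erase (interp ((b, V) # L)) T)))"
    by (rule steps_bind_right)
  show ?case
  proof (cases b)
    case Declaration
    with T steps_bind_left[OF V] show ?thesis by (auto simp: bind_defs intro: steps_trans0)
  next
    case Definition
    let ?t = "quote (decls L) (erase (bind_sub b (erase (interp L) V) (interp L)) T)"
    \<comment> \<open>After erasure the defined variable has been unfolded everywhere, so the body
      is a lifted term and \<open>zeta\<close> removes the definition.\<close>
    have "quote (decls ((b, V) # L)) (erase (interp ((b, V) # L)) T) = lift 0 ?t"
      using quote_decls_ren[of b V L] Definition by (simp add: lift_quote)
    moreover have "steps nxt L 0 (Def V (lift 0 ?t)) ?t" by (intro steps.single step.zeta)
    ultimately show ?thesis using T Definition by (auto simp: bind_lam_def intro: steps_trans0)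
  qed
next
  case (Cast U T)
  have "steps nxt L 0 (Cast U T) T" by (intro steps.single step.eps)
  with Cast show ?case by (auto intro: steps_trans0)
qed auto

lemma steps_quote_erase: "steps nxt L 0 T (quote (decls L) (erase (interp L) T))"
proof (rule steps_quote_erase_aux)
  show "steps nxt L 0 (Var i) (quote (decls L) (interp L i))" for i
  proof (induction L arbitrary: i)
    case (Cons e L)
    from steps_Var_Cons[OF Cons steps_quote_erase_aux[OF Cons], of "fst e" "snd e"]
    show ?case by simp
  qed (simp add: steps.refl)
qed

text \<open>The source calculus contracts every beta redex, so \<open>\<Gamma>\<close> and
  \<open>L\<close> are unrelated. It leaves a local definition of a cast; reading back the erasure
  of that term performs the substitution.\<close>

lemma steps_quote_pred:
  assumes "pred nxt \<Gamma> t t'"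
  shows "steps nxt L 0 (quote (decls L) t) (quote (decls L) t')"
  using assms
proof (induction arbitrary: L rule: pred_conv.inducts(1)[where ?P2.0 = "\<lambda>_ _ _. True"])
  case (Ap \<Gamma> v v' t t')
  then show ?case by (simp add: steps_App)
next
  case (Lm \<Gamma> w w' t t')
  have "steps nxt ((Declaration, quote (decls L) w) # L) 0 (quote (upr (decls L)) t) (quote (upr (decls L)) t')"
    using Lm.IH(2)[of "(Declaration, quote (decls L) w) # L"] by simp
  with Lm.IH(1)[of L] show ?case
    by (simp add: steps_Bind)
next
  case (beta \<Gamma> v w v' t t')
  let ?q = "quote (decls L)" and ?q' = "quote (upr (decls L))"
  have "steps nxt ((Declaration, ?q w) # L) 0 (?q' t) (?q' t')"
    using beta.IH(2)[of "(Declaration, ?q w) # L"] by simp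
  then have "steps nxt L 0 (App (?q v) (Lambda (?q w) (?q' t))) (App (?q v) (Lambda (?q w) (?q' t')))"
    by (intro steps_app_right steps_bind_right)
  moreover have "steps nxt L 0 (App (?q v) (Lambda (?q w) (?q' t'))) (App (?q v') (Lambda (?q w) (?q' t')))"
    by (intro steps_app_left beta.IH(1))
  moreover have "steps nxt L 0 (App (?q v') (Lambda (?q w) (?q' t'))) (Def (Cast (?q w) (?q v')) (?q' t'))"
    by (intro steps.single step.beta)
  moreover have "steps nxt L 0 (Def (Cast (?q w) (?q v')) (?q' t')) (?q (sub (case_nat v' Idx) t'))"
  proof -
    have "(\<lambda>i. case_nat v' (interp L) (upr (decls L) i)) = case_nat v' Idx"
      by (auto simp: interp_decls split: nat.split)
    then have "erase (interp L) (Def (Cast (?q w) (?q v')) (?q' t')) = sub (case_nat v' Idx) t'"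
      by (simp add: bind_defs erase_quote interp_decls sub_Idx)
    with steps_quote_erase show ?thesis by metis
  qed
  ultimately show ?case by (auto intro: steps_trans0)
qed (auto intro: steps.refl)

lemma steps_erase_preds:
  assumes "preds nxt \<Gamma> (erase (interp L) T) t"
  shows "steps nxt L 0 T (quote (decls L) t)"
  using assms
proof (induction)
  case base
  then show ?case by (rule steps_quote_erase)
next
  case (step t t')
  then show ?case by (auto intro: steps_trans0 steps_quote_pred)
qed

text \<open>The erasures have a common reduct; equal \<open>decls\<close> ensure that both
  environments quote it as the same term.\<close>

lemma steps_erase_conv:
  assumes "conv nxt \<Gamma> (erase (interp L1) T1) (erase (interp L2) T2)" "decls L1 = decls L2"
  shows "\<exists>T. steps nxt L1 0 T1 T \<and> steps nxt L2 0 T2 T"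
  using assms by (metis conv_join steps_erase_preds)

section \<open>Validity and semantic validity\<close>

lemma ex_steps_Var_Cons:
  assumes "\<And>i. Q i \<Longrightarrow> \<exists>T'. steps nxt K 1 (Var i) T'" "q \<Longrightarrow> \<exists>T'. steps nxt K 1 V T'" "case_nat q Q i"
  shows "\<exists>T'. steps nxt ((b, V) # K) 1 (Var i) T'"
proof (cases i)
  case 0
  show ?thesis
  proof (cases b)
    case Declaration
    with 0 show ?thesis by (metis steps.single step.decl)
  next
    case Definition
    from 0 assms obtain T' where "steps nxt K 1 V T'" by auto
    from steps_trans0[OF steps.single[OF step.delta] steps_lift[OF this]] 0 Definition
    show ?thesis by blast
  qed
next
  case (Suc j)
  with assms obtain T' where "steps nxt K 1 (Var j) T'" by auto
  from steps_lift[OF this] Suc show ?thesis by auto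
qed

text \<open>Sorts and casts step at once, applications and binders pass to the right component, and
  the only possible obstacle, a head variable without a usable entry, is excluded by
  \<open>Q\<close>.\<close>

lemma ex_steps_1_aux:
  assumes "sound nxt A \<rho> \<Gamma> Q T" "\<And>i. Q i \<Longrightarrow> \<exists>T'. steps nxt L 1 (Var i) T'"
  shows "\<exists>T'. steps nxt L 1 T T'"
  using assms
proof (induction T arbitrary: \<rho> \<Gamma> Q L)
  case (Sort s)
  show ?case by (metis steps.single step.sort)
next
  case (App V T)
  from App.prems have "sound nxt A \<rho> \<Gamma> Q T" by simp
  from App.IH(2)[OF this App.prems(2)] show ?case by (blast intro: steps_app_right)
next
  case (Bind b V T)
  let ?v = "erase \<rho> V"
  from Bind.prems have "sound nxt A \<rho> \<Gamma> Q V"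
    and T: "sound nxt A (bind_sub b ?v \<rho>) (bind_ctx b ?v \<Gamma>) (case_nat True Q) T"
    by simp_all
  from Bind.IH(1)[OF this(1) Bind.prems(2)] have V: "\<exists>T'. steps nxt L 1 V T'" .
  from Bind.IH(2)[OF T ex_steps_Var_Cons[OF Bind.prems(2) V]]
  have "\<exists>T'. steps nxt ((b, V) # L) 1 T T'" .
  then show ?case by (blast intro: steps_bind_right)
next
  case (Cast U T)
  show ?case by (metis steps.single step.cast_type)
qed auto

lemma ex_steps_1:
  assumes "okctx nxt A L \<Gamma> Q" "sound nxt A (interp L) \<Gamma> Q T"
  shows "\<exists>T'. steps nxt L 1 T T'"
proof -
  have "\<exists>T'. steps nxt L 1 (Var i) T'" if "Q i" for i
    using assms(1) that
  proof (induction arbitrary: i)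
    case (used K \<Gamma> Q V b)
    from used.IH ex_steps_1_aux[OF used.hyps(2) used.IH] used.prems
    show ?case by (rule ex_steps_Var_Cons)
  next
    case (unused K \<Gamma> Q b V v)
    then show ?case using ex_steps_Var_Cons[of Q nxt K False] by blast
  qed auto
  with assms(2) show ?thesis by (rule ex_steps_1_aux)
qed

lemma ex_steps:
  assumes "okctx nxt A L \<Gamma> Q" "sound nxt A (interp L) \<Gamma> Q T"
  shows "\<exists>T'. steps nxt L n T T'"
proof (induction n)
  case 0
  show ?case by (blast intro: steps.refl)
next
  case (Suc n)
  then obtain T' where T': "steps nxt L n T T'" by blast
  with sound_steps[OF T' assms] ex_steps_1[OF assms(1)] obtain T'' where "steps nxt L 1 T' T''"
    by blast
  from steps.trans[OF T' this] show ?case by auto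
qed

text \<open>The reductions required by validity are built from conversions: \<open>ex_steps\<close>
  reaches the right degree, confluence joins the erasures, and the common reduct is quoted.\<close>

lemma sound_imp_valid_aux:
  assumes "sound nxt A (interp L) \<Gamma> Q T" "okctx nxt A L \<Gamma> Q" "\<And>i. Q i \<Longrightarrow> valid nxt A L (Var i)"
  shows "valid nxt A L T"
  using assms
proof (induction T arbitrary: L \<Gamma> Q)
  case (Sort s)
  show ?case by (rule valid.sort)
next
  case (Var i)
  then show ?case by simp
next
  case (App V T)
  have sV: "sound nxt A (interp L) \<Gamma> Q V" and sT: "sound nxt A (interp L) \<Gamma> Q T"
    using App.prems by auto
  obtain n w u where n: "n \<in> A" "conv nxt \<Gamma> (tys nxt \<Gamma> n (erase (interp L) T)) (Lm w u)"
    "conv nxt \<Gamma> (ty nxt \<Gamma> (erase (interp L) V)) w"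
    using App.prems by auto
  obtain T' where T': "steps nxt L n T T'" using ex_steps App.prems(2) sT by blast
  obtain V' where V': "steps nxt L 1 V V'" using ex_steps App.prems(2) sV by blast
  have "conv nxt \<Gamma> (erase (interp L) T') (Lm w u)"
    using sound_steps[OF T' App.prems(2) sT] n(2) by (blast intro: conv_trans[OF conv_sym])
  then obtain z where z: "preds nxt \<Gamma> (erase (interp L) T') z" "preds nxt \<Gamma> (Lm w u) z"
    by (rule conv_join)
  then obtain w1 u1 where w1: "z = Lm w1 u1" "preds nxt \<Gamma> w w1" using preds_Lm by blast
  have "conv nxt \<Gamma> (ty nxt \<Gamma> (erase (interp L) V)) (erase (interp L) V')"
    using sound_steps[OF V' App.prems(2) sV] by simp
  \<comment> \<open>The type of \<open>V\<close> and the annotation \<open>w1\<close> are only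
    convertible; the abstraction is reduced further, to annotation \<open>w2\<close>, so that both
    sides reach the same \<open>W0\<close>.\<close>
  from conv_trans[OF conv_sym[OF this] conv_trans[OF n(3) preds_conv[OF w1(2)]]]
  obtain w2 where w2: "preds nxt \<Gamma> (erase (interp L) V') w2" "preds nxt \<Gamma> w1 w2"
    by (rule conv_join)
  have "preds nxt \<Gamma> (Lm w1 u1) (Lm w2 u1)"
    using w2(2) by induction (auto intro: rtranclp.rtrancl_into_rtrancl pred_conv.Lm pred_refl)
  with z w1 have "preds nxt \<Gamma> (erase (interp L) T') (Lm w2 u1)" by auto
  from steps_trans0'[OF T' steps_erase_preds[OF this]]
  have "steps nxt L n T (Lambda (quote (decls L) w2) (quote (upr (decls L)) u1))" by simp
  moreover have "steps nxt L 1 V (quote (decls L) w2)"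
    using steps_trans0'[OF V' steps_erase_preds[OF w2(1)]] .
  ultimately show ?case
    using n(1) App.IH(1)[OF sV App.prems(2,3)] App.IH(2)[OF sT App.prems(2,3)] valid.app by blast
next
  case (Bind b V T)
  have sV: "sound nxt A (interp L) \<Gamma> Q V" using Bind.prems by simp
  have V: "valid nxt A L V" by (rule Bind.IH(1)[OF sV Bind.prems(2,3)])
  have "valid nxt A ((b, V) # L) (Var i)" if "case_nat True Q i" for i
    using that V Bind.prems(3) by (cases i) (auto intro: valid.intros)
  moreover have "okctx nxt A ((b, V) # L) (bind_ctx b (erase (interp L) V) \<Gamma>) (case_nat True Q)"
    using Bind.prems(2) sV by (rule okctx.used)
  ultimately have "valid nxt A ((b, V) # L) T"
    using Bind.prems(1) by (intro Bind.IH(2)[where Q = "case_nat True Q"]) auto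
  with V show ?case by (rule valid.bind)
next
  case (Cast U T)
  have sU: "sound nxt A (interp L) \<Gamma> Q U" and sT: "sound nxt A (interp L) \<Gamma> Q T"
    and c: "conv nxt \<Gamma> (ty nxt \<Gamma> (erase (interp L) T)) (erase (interp L) U)"
    using Cast.prems by auto
  obtain T' where T': "steps nxt L 1 T T'" using ex_steps Cast.prems(2) sT by blast
  have "conv nxt \<Gamma> (ty nxt \<Gamma> (erase (interp L) T)) (erase (interp L) T')"
    using sound_steps[OF T' Cast.prems(2) sT] by simp
  from steps_erase_conv[OF conv_trans[OF conv_sym[OF this] c] HOL.refl]
  obtain U0 where "steps nxt L 0 T' U0" "steps nxt L 0 U U0" by blast
  with steps_trans0'[OF T'] show ?case
    using Cast.IH(1)[OF sU Cast.prems(2,3)] Cast.IH(2)[OF sT Cast.prems(2,3)] valid.cast by blast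
qed

lemma sound_imp_valid:
  assumes "okctx nxt A L \<Gamma> Q" "sound nxt A (interp L) \<Gamma> Q T"
  shows "valid nxt A L T"
proof -
  have "valid nxt A L (Var i)" if "Q i" for i
    using assms(1) that
  proof (induction arbitrary: i)
    case (used K \<Gamma> Q V b)
    have "valid nxt A K V" using used.hyps(2,1) used.IH by (rule sound_imp_valid_aux)
    with used.prems used.IH show ?case by (cases i) (auto intro: valid.intros)
  next
    case (unused K \<Gamma> Q b V v)
    then show ?case by (cases i) (auto intro: valid.intros)
  qed simp
  with assms(2,1) show ?thesis by (rule sound_imp_valid_aux)
qed

section \<open>From validity to semantic validity\<close>

lemma valid_Var_Suc: "valid nxt A ((b, V) # K) (Var (Suc i)) \<Longrightarrow> valid nxt A K (Var i)"
  by (cases rule: valid.cases) auto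

lemma valid_Var_0: "valid nxt A ((b, V) # K) (Var 0) \<Longrightarrow> valid nxt A K V"
  by (cases rule: valid.cases) auto

lemma valid_imp_sound:
  assumes "valid nxt A L T" "okctx nxt A L \<Gamma> Q" "\<And>i. valid nxt A L (Var i) \<Longrightarrow> Q i"
  shows "sound nxt A (interp L) \<Gamma> Q T"
  using assms
proof (induction arbitrary: \<Gamma> Q)
  case (var_0 K V b)
  then show ?case by (auto intro: valid.var_0)
next
  case (var_Suc K i b V)
  then show ?case by (auto intro: valid.var_Suc)
next
  case (bind L V b T)
  have V: "sound nxt A (interp L) \<Gamma> Q V" by (rule bind.IH(1)[OF bind.prems])
  have "case_nat True Q i" if "valid nxt A ((b, V) # L) (Var i)" for i
    using that bind.prems(2) by (cases i) (auto dest: valid_Var_Suc)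
  with bind.IH(2)[OF okctx.used[OF bind.prems(1) V]] V show ?case by simp
next
  case (cast L U T U0)
  have U: "sound nxt A (interp L) \<Gamma> Q U" and T: "sound nxt A (interp L) \<Gamma> Q T"
    using cast.IH cast.prems by blast+
  have "conv nxt \<Gamma> (ty nxt \<Gamma> (erase (interp L) T)) (erase (interp L) U0)"
    "conv nxt \<Gamma> (erase (interp L) U) (erase (interp L) U0)"
    using sound_steps[OF cast.hyps(3) cast.prems(1) T] sound_steps[OF cast.hyps(4) cast.prems(1) U]
    by auto
  with U T show ?case by (auto intro: conv_trans conv_sym)
next
  case (app L V T n W0 U0)
  have V: "sound nxt A (interp L) \<Gamma> Q V" and T: "sound nxt A (interp L) \<Gamma> Q T"
    using app.IH app.prems by blast+
  have "conv nxt \<Gamma> (ty nxt \<Gamma> (erase (interp L) V)) (erase (interp L) W0)"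
    "conv nxt \<Gamma> (tys nxt \<Gamma> n (erase (interp L) T)) (Lm (erase (interp L) W0) (erase (ups (interp L)) U0))"
    using sound_steps[OF app.hyps(5) app.prems(1) V] sound_steps[OF app.hyps(4) app.prems(1) T]
    by (auto simp: bind_defs)
  with V T app.hyps(3) show ?case by auto
qed simp

text \<open>No validity of the environment is assumed, so each entry is classified by whether it is
  valid in its own tail.\<close>

lemma ex_okctx: "\<exists>\<Gamma> Q. okctx nxt A L \<Gamma> Q \<and> (\<forall>i. valid nxt A L (Var i) \<longrightarrow> Q i)"
proof (induction L)
  case Nil
  have "\<not> valid nxt A [] (Var i)" for i by (auto elim: valid.cases)
  then show ?case using okctx.nil by blast
next
  case (Cons e L)
  obtain b V where e: "e = (b, V)" by (cases e)
  obtain \<Gamma> Q where Q: "okctx nxt A L \<Gamma> Q" "\<And>i. valid nxt A L (Var i) \<Longrightarrow> Q i"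
    using Cons by blast
  show ?case
  proof (cases "valid nxt A L V")
    case True
    have "sound nxt A (interp L) \<Gamma> Q V" using True Q by (rule valid_imp_sound)
    with Q(1) have "okctx nxt A (e # L) (bind_ctx b (erase (interp L) V) \<Gamma>) (case_nat True Q)"
      unfolding e by (rule okctx.used)
    moreover have "case_nat True Q i" if "valid nxt A (e # L) (Var i)" for i
      using that Q(2) unfolding e by (cases i) (auto dest: valid_Var_Suc)
    ultimately show ?thesis by blast
  next
    case False
    \<comment> \<open>An invalid entry makes index 0 invalid; its type is an arbitrary value and its
      flag is false.\<close>
    have "okctx nxt A (e # L) (bind_ctx b undefined \<Gamma>) (case_nat False Q)"
      unfolding e using Q(1) by (rule okctx.unused)
    moreover have "case_nat False Q i" if "valid nxt A (e # L) (Var i)" for i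
      using that Q(2) False unfolding e by (cases i) (auto dest: valid_Var_Suc valid_Var_0)
    ultimately show ?thesis by blast
  qed
qed

section \<open>Reduction of environments\<close>

lemma decls_env_step: "env_step nxt L L' \<Longrightarrow> decls L' = decls L"
  by (induction rule: env_step.induct) (simp_all split: binder_kind.split)

lemma mor_bind_ctx:
  assumes "mor nxt \<Gamma> \<Delta> Idx" "conv nxt \<Delta> v' v"
  shows "mor nxt (bind_ctx b v \<Gamma>) (bind_ctx b v' \<Delta>) Idx"
proof (cases b)
  case Declaration
  have "conv nxt (dec \<Delta> v') (dec \<Delta> v' i) (dec \<Gamma> v i)" for i
    using assms by (cases i) (simp_all add: conv_ren_Suc mor_Idx_iff)
  with Declaration show ?thesis by (simp add: bind_ctx_def mor_Idx_iff)
qed (use assms in \<open>simp add: bind_ctx_def\<close>)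

lemma conv_interp_Cons:
  assumes "\<And>i. Q i \<Longrightarrow> conv nxt \<Gamma> (interp K i) (interp K' i)"
    and "q \<Longrightarrow> conv nxt \<Gamma> (erase (interp K) V) (erase (interp K') V')" and "case_nat q Q i"
  shows "conv nxt (bind_ctx b v \<Gamma>) (interp ((b, V) # K) i) (interp ((b, V') # K') i)"
proof (cases i)
  case 0
  with assms show ?thesis by (cases b) (simp_all add: bind_defs conv_refl)
next
  case (Suc j)
  with assms show ?thesis by (simp add: bind_sub_Suc conv_bind_ren)
qed

text \<open>The morphism into \<open>\<Gamma>'\<close> transports soundness to the reduced
  environment; the one back returns conversions to \<open>\<Gamma>\<close>, where two different
  reducts of \<open>L\<close> can be compared.\<close>

lemma okctx_env_step:
  assumes "env_step nxt L L'" "okctx nxt A L \<Gamma> Q"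
  shows "\<exists>\<Gamma>'. okctx nxt A L' \<Gamma>' Q \<and> mor nxt \<Gamma> \<Gamma>' Idx \<and> mor nxt \<Gamma>' \<Gamma> Idx \<and>
    (\<forall>i. Q i \<longrightarrow> conv nxt \<Gamma> (interp L i) (interp L' i))"
  using assms
proof (induction arbitrary: \<Gamma> Q)
  case (tail K1 K2 b V)
  from tail.prems show ?case
  proof (cases rule: okctx.cases)
    case (used \<Gamma>0 Q0)
    obtain \<Gamma>' where \<Gamma>': "okctx nxt A K2 \<Gamma>' Q0" "mor nxt \<Gamma>0 \<Gamma>' Idx" "mor nxt \<Gamma>' \<Gamma>0 Idx"
      "\<And>i. Q0 i \<Longrightarrow> conv nxt \<Gamma>0 (interp K1 i) (interp K2 i)"
      using tail.IH used by blast
    have "conv nxt \<Gamma>' (interp K2 i) (sub Idx (interp K1 i))" if "Q0 i" for i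
      using conv_sym[OF conv_mor_Idx[OF \<Gamma>'(4)[OF that] \<Gamma>'(2)]] by (simp add: sub_Idx)
    with \<Gamma>' used have V: "conv nxt \<Gamma>' (erase (interp K2) V) (erase (interp K1) V)"
      "sound nxt A (interp K2) \<Gamma>' Q0 V"
      using erase_sound_mor[OF _ \<Gamma>'(2)] by (force simp: sub_Idx)+
    have V': "conv nxt \<Gamma>0 (erase (interp K1) V) (erase (interp K2) V)"
      using conv_mor_Idx[OF conv_sym[OF V(1)] \<Gamma>'(3)] .
    have "okctx nxt A ((b, V) # K2) (bind_ctx b (erase (interp K2) V) \<Gamma>') Q"
      using \<Gamma>'(1) V(2) used by (auto intro: okctx.used)
    moreover have "conv nxt \<Gamma> (interp ((b, V) # K1) i) (interp ((b, V) # K2) i)" if "Q i" for i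
      using conv_interp_Cons[of Q0 nxt \<Gamma>0 K1 K2 True V V] \<Gamma>'(4) V' that used by blast
    ultimately show ?thesis using used V(1) V' \<Gamma>'(2,3) mor_bind_ctx by blast
  next
    case (unused \<Gamma>0 Q0 v)
    obtain \<Gamma>' where \<Gamma>': "okctx nxt A K2 \<Gamma>' Q0" "mor nxt \<Gamma>0 \<Gamma>' Idx" "mor nxt \<Gamma>' \<Gamma>0 Idx"
      "\<And>i. Q0 i \<Longrightarrow> conv nxt \<Gamma>0 (interp K1 i) (interp K2 i)"
      using tail.IH unused by blast
    have "okctx nxt A ((b, V) # K2) (bind_ctx b v \<Gamma>') Q"
      using \<Gamma>'(1) unused by (auto intro: okctx.unused)
    moreover have "conv nxt \<Gamma> (interp ((b, V) # K1) i) (interp ((b, V) # K2) i)" if "Q i" for i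
      using conv_interp_Cons[of Q0 nxt \<Gamma>0 K1 K2 False V V] \<Gamma>'(4) that unused by blast
    ultimately show ?thesis using unused \<Gamma>'(2,3) mor_bind_ctx conv_refl by blast
  qed
next
  case (head K V1 V2 b)
  from head.prems show ?case
  proof (cases rule: okctx.cases)
    case (used \<Gamma>0 Q0)
    have V: "sound nxt A (interp K) \<Gamma>0 Q0 V2" "conv nxt \<Gamma>0 (erase (interp K) V1) (erase (interp K) V2)"
      using sound_step[OF head.hyps] used by auto
    have "okctx nxt A ((b, V2) # K) (bind_ctx b (erase (interp K) V2) \<Gamma>0) Q"
      using V(1) used by (auto intro: okctx.used)
    moreover have "conv nxt \<Gamma> (interp ((b, V1) # K) i) (interp ((b, V2) # K) i)" if "Q i" for i
      using conv_interp_Cons[of Q0 nxt \<Gamma>0 K K True V1 V2] conv_refl V(2) that used by blast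
    ultimately show ?thesis using used V(2) mor_bind_ctx mor_Idx conv_sym by blast
  next
    case (unused \<Gamma>0 Q0 v)
    have "okctx nxt A ((b, V2) # K) \<Gamma> Q"
      using unused by (auto intro: okctx.unused)
    moreover have "conv nxt \<Gamma> (interp ((b, V1) # K) i) (interp ((b, V2) # K) i)" if "Q i" for i
      using conv_interp_Cons[of Q0 nxt \<Gamma>0 K K False V1 V2] conv_refl that unused by blast
    ultimately show ?thesis using mor_Idx by blast
  qed
qed

lemma sound_env_step:
  assumes "env_step nxt L L'" "okctx nxt A L \<Gamma> Q" "sound nxt A (interp L) \<Gamma> Q T"
  obtains \<Gamma>' where "okctx nxt A L' \<Gamma>' Q" "mor nxt \<Gamma>' \<Gamma> Idx" "sound nxt A (interp L') \<Gamma>' Q T"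
    "conv nxt \<Gamma> (erase (interp L) T) (erase (interp L') T)"
proof -
  from okctx_env_step[OF assms(1,2)] obtain \<Gamma>' where
    \<Gamma>': "okctx nxt A L' \<Gamma>' Q" "mor nxt \<Gamma> \<Gamma>' Idx" "mor nxt \<Gamma>' \<Gamma> Idx"
      "\<And>i. Q i \<Longrightarrow> conv nxt \<Gamma> (interp L i) (interp L' i)"
    by blast
  have "conv nxt \<Gamma>' (interp L' i) (sub Idx (interp L i))" if "Q i" for i
    using conv_sym[OF conv_mor_Idx[OF \<Gamma>'(4)[OF that] \<Gamma>'(2)]] by (simp add: sub_Idx)
  from erase_sound_mor[OF assms(3) \<Gamma>'(2) this]
  have "conv nxt \<Gamma>' (erase (interp L') T) (erase (interp L) T)" "sound nxt A (interp L') \<Gamma>' Q T"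
    by (simp_all add: sub_Idx)
  with \<Gamma>' that show ?thesis using conv_mor_Idx[OF conv_sym] by blast
qed

text \<open>One side of confluence: any number \<open>d\<close> of further degrees can be run in
  \<open>L'\<close>, and the end term represents a static type of \<open>T\<close> that depends only
  on \<open>d + n\<close>.\<close>

lemma ex_steps_env_step:
  assumes "env_step nxt L L'" "okctx nxt A L \<Gamma> Q" "sound nxt A (interp L) \<Gamma> Q T" "steps nxt L n T T1"
  obtains T' where "steps nxt L' d T1 T'"
    "conv nxt \<Gamma> (tys nxt \<Gamma> (d + n) (erase (interp L) T)) (erase (interp L') T')"
proof -
  have T1: "sound nxt A (interp L) \<Gamma> Q T1"
    "conv nxt \<Gamma> (tys nxt \<Gamma> n (erase (interp L) T)) (erase (interp L) T1)"
    using sound_steps[OF assms(4,2,3)] by auto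
  from assms(1,2) T1(1) obtain \<Gamma>' where \<Gamma>': "okctx nxt A L' \<Gamma>' Q" "mor nxt \<Gamma>' \<Gamma> Idx"
      "sound nxt A (interp L') \<Gamma>' Q T1" "conv nxt \<Gamma> (erase (interp L) T1) (erase (interp L') T1)"
    by (rule sound_env_step)
  obtain T' where T': "steps nxt L' d T1 T'" using ex_steps[OF \<Gamma>'(1,3)] by blast
  have "conv nxt \<Gamma> (tys nxt \<Gamma> (d + n) (erase (interp L) T)) (tys nxt \<Gamma> d (erase (interp L') T1))"
    unfolding tys_add by (rule tys_conv[OF conv_trans[OF T1(2) \<Gamma>'(4)]])
  \<comment> \<open>Static types in \<open>\<Gamma>\<close> and \<open>\<Gamma>'\<close> agree up to
    conversion because \<open>Idx\<close> is a morphism.\<close>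
  also have "conv nxt \<Gamma> \<dots> (tys nxt \<Gamma>' d (erase (interp L') T1))"
    using tys_sub[OF \<Gamma>'(2)] by (simp add: sub_Idx)
  also have "conv nxt \<Gamma> \<dots> (erase (interp L') T')"
    using sound_steps[OF T' \<Gamma>'(1,3)] \<Gamma>'(2) conv_mor_Idx by blast
  finally show ?thesis using T' that by blast
qed

theorem theorem5p1:
  fixes nxt :: "'s \<Rightarrow> 's" and A :: "nat set" and L :: "'s env" and T :: "'s tm"
  assumes "valid nxt A L T"
  shows "(\<forall>L1 L2 T1 T2 n1 n2.
            env_step nxt L L1 \<longrightarrow> env_step nxt L L2 \<longrightarrow>
            steps nxt L n1 T T1 \<longrightarrow> steps nxt L n2 T T2 \<longrightarrow>
            (\<exists>T'. steps nxt L1 (n2 - n1) T1 T' \<and> steps nxt L2 (n1 - n2) T2 T'))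
       \<and> (\<forall>L2 T2 n. env_step nxt L L2 \<longrightarrow> step nxt L n T T2 \<longrightarrow> valid nxt A L2 T2)"
proof (intro conjI allI impI)
  obtain \<Gamma> Q where ctx: "okctx nxt A L \<Gamma> Q" and "\<And>i. valid nxt A L (Var i) \<Longrightarrow> Q i"
    using ex_okctx by blast
  then have T: "sound nxt A (interp L) \<Gamma> Q T" using assms valid_imp_sound by blast
  {
    fix L1 L2 T1 T2 n1 n2
    assume L: "env_step nxt L L1" "env_step nxt L L2"
      and steps: "steps nxt L n1 T T1" "steps nxt L n2 T T2"
    from L(1) ctx T steps(1) obtain T1' where T1': "steps nxt L1 (n2 - n1) T1 T1'"
      "conv nxt \<Gamma> (tys nxt \<Gamma> (n2 - n1 + n1) (erase (interp L) T)) (erase (interp L1) T1')"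
      by (rule ex_steps_env_step)
    from L(2) ctx T steps(2) obtain T2' where T2': "steps nxt L2 (n1 - n2) T2 T2'"
      "conv nxt \<Gamma> (tys nxt \<Gamma> (n1 - n2 + n2) (erase (interp L) T)) (erase (interp L2) T2')"
      by (rule ex_steps_env_step)
    \<comment> \<open>With truncated subtraction both sums are the maximum of \<open>n1\<close> and
      \<open>n2\<close>, so both end terms represent the same iterated static type of
      \<open>T\<close>.\<close>
    have "n2 - n1 + n1 = n1 - n2 + n2" by simp
    with T1' T2' have "conv nxt \<Gamma> (erase (interp L1) T1') (erase (interp L2) T2')"
      by (metis conv_sym conv_trans)
    \<comment> \<open>Environment steps keep the kinds of entries, hence the positions of
      declarations.\<close>
    moreover have "decls L1 = decls L2" using L by (simp add: decls_env_step)
    ultimately obtain T' where "steps nxt L1 0 T1' T'" "steps nxt L2 0 T2' T'"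
      using steps_erase_conv by blast
    with T1' T2' show "\<exists>T'. steps nxt L1 (n2 - n1) T1 T' \<and> steps nxt L2 (n1 - n2) T2 T'"
      by (blast intro: steps_trans0')
  }
  {
    fix L2 T2 n
    assume L: "env_step nxt L L2" and "step nxt L n T T2"
    with sound_step ctx T have "sound nxt A (interp L) \<Gamma> Q T2" by blast
    with L ctx obtain \<Gamma>' where "okctx nxt A L2 \<Gamma>' Q" "sound nxt A (interp L2) \<Gamma>' Q T2"
      by (rule sound_env_step)
    then show "valid nxt A L2 T2" by (rule sound_imp_valid)
  }
qed

end
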